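(* Let $K$ be a field and let $Y=\mathbb{P}^{n_1}\times\cdots\times\mathbb{P}^{n_k}$ with $n_i>0$ for all $i$. Let $S\subset Y$ be a nondegenerate set with $\#(S)=5$ and $e(S)\ge 2$. Let $A$ be the kernel of $S$ and let $Y'=\mathbb{P}^{m_1}\times\cdots\times\mathbb{P}^{m_s}$, $s\ge 1$ (with $m_1,\dots,m_s\geq 1$), be the minimal multiprojective space containing $A$. Then $A$, $e(S)$ and $Y'$ are in the following list, and all the numerical values in the list are realized by some $S$: (1) $e(S)=3$, $A=S$, $s=1$ and $m_1=1$; (2) $e(S)=2$, $A=S$, $s=1$ and $m_1=2$; (3) $e(S)=2$, $A=S$, $s=2$ and $m_1=m_2=1$; (4) $e(S)=2$, $\#(A)=4$, $s=1$ and $m_1=1$.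
   Context: Finite subsets of $Y$ consist of points defined over $K$. Set $r=-1+\prod_{i=1}^k(n_i+1)$; $\nu:Y\to\mathbb{P}^r$ is the Segre embedding, $\pi_i:Y\to\mathbb{P}^{n_i}$ is the $i$-th projection, and $\langle\ \rangle$ denotes linear span. For a finite set $S\subset Y$ put $e(S)=\#(S)-1-\dim\langle\nu(S)\rangle$. The minimal multiprojective space containing a finite set $A\subset Y$ is $\prod_{i=1}^k\langle\pi_i(A)\rangle$; writing it as $\mathbb{P}^{m_1}\times\cdots\times\mathbb{P}^{m_s}$ one keeps only the positive-dimensional factors. $S$ is nondegenerate if $\prod_{i=1}^k\langle\pi_i(S)\rangle=Y$. For a finite set $S\subset Y$ with $e(S)>0$, a kernel of $S$ is a minimal (for inclusion) subset $S'\subseteq S$ such that $e(S')=e(S)$; it is known that the kernel is unique.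
   Formalization: The values in (1) are shown to be realized only when K has at least 4 elements, and those in (4) only when K has at least 3; over smaller fields the line has too few K-points, so realization fails. (2), (3) and the classification hold over every field. *)

theory Defs
  imports Complex_Main "HOL-Library.FuncSet" "HOL-Library.Function_Algebras"
begin

definition fscale :: "'a::field \<Rightarrow> ('i \<Rightarrow> 'a) \<Rightarrow> 'i \<Rightarrow> 'a" where
  "fscale c f = (\<lambda>i. c * f i)"

global_interpretation fvs: vector_space "fscale :: 'a::field \<Rightarrow> ('i \<Rightarrow> 'a) \<Rightarrow> 'i \<Rightarrow> 'a"
  by unfold_locales (auto simp: fscale_def algebra_simps fun_eq_iff)

text \<open>The vector space \<open>K^I\<close>, as the functions vanishing outside \<open>I\<close>; in this way
  the spaces \<open>K^(n+1)\<close> for all \<open>n\<close> live in one type.\<close>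

definition coord_space :: "'i set \<Rightarrow> ('i \<Rightarrow> 'a::field) set" where
  "coord_space I = {f. \<forall>i. i \<notin> I \<longrightarrow> f i = 0}"

text \<open>A point of a projective space is a line through the origin. \<open>proj_of W\<close> is the
  projective space \<open>P(W)\<close> of a linear subspace \<open>W\<close>, as a set of points.\<close>

definition proj_of :: "('i \<Rightarrow> 'a::field) set \<Rightarrow> ('i \<Rightarrow> 'a) set set" where
  "proj_of W = {fvs.span {v} | v. v \<in> W \<and> v \<noteq> 0}"

definition proj_space :: "nat \<Rightarrow> (nat \<Rightarrow> 'a::field) set set" where
  "proj_space n = proj_of (coord_space {..n})"

definition lin_span :: "('i \<Rightarrow> 'a::field) set set \<Rightarrow> ('i \<Rightarrow> 'a) set set" where
  "lin_span T = proj_of (fvs.span (\<Union>T))"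

text \<open>Meant for linear subspaces of a projective space; the empty one has dimension \<open>-1\<close>.\<close>

definition pdim :: "('i \<Rightarrow> 'a::field) set set \<Rightarrow> int" where
  "pdim L = int (fvs.dim (\<Union>L)) - 1"

definition multiproj :: "nat \<Rightarrow> (nat \<Rightarrow> nat) \<Rightarrow> (nat \<Rightarrow> (nat \<Rightarrow> 'a::field) set) set" where
  "multiproj k n = (\<Pi>\<^sub>E i\<in>{..<k}. proj_space (n i))"

text \<open>The homogeneous coordinates of the target \<open>P^r\<close> of the Segre embedding are indexed
  by the multi-indices, of which there are \<open>r + 1\<close> (see \<open>card_multi_idx\<close>).\<close>

definition multi_idx :: "nat \<Rightarrow> (nat \<Rightarrow> nat) \<Rightarrow> (nat \<Rightarrow> nat) set" where
  "multi_idx k n = (\<Pi>\<^sub>E i\<in>{..<k}. {..n i})"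

definition tensor :: "nat \<Rightarrow> (nat \<Rightarrow> nat) \<Rightarrow> (nat \<Rightarrow> nat \<Rightarrow> 'a::field) \<Rightarrow> (nat \<Rightarrow> nat) \<Rightarrow> 'a" where
  "tensor k n v = (\<lambda>j. if j \<in> multi_idx k n then \<Prod>i<k. v i (j i) else 0)"

text \<open>All choices of representatives \<open>v i\<close> of the points \<open>y i\<close> give proportional tensors;
  see \<open>segre_point\<close> for the value in terms of a single choice.\<close>

definition segre ::
    "nat \<Rightarrow> (nat \<Rightarrow> nat) \<Rightarrow> (nat \<Rightarrow> (nat \<Rightarrow> 'a::field) set) \<Rightarrow> ((nat \<Rightarrow> nat) \<Rightarrow> 'a) set" where
  "segre k n y = fvs.span {tensor k n v | v. \<forall>i<k. v i \<in> y i}"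

definition excess ::
    "nat \<Rightarrow> (nat \<Rightarrow> nat) \<Rightarrow> (nat \<Rightarrow> (nat \<Rightarrow> 'a::field) set) set \<Rightarrow> int" where
  "excess k n S = int (card S) - 1 - pdim (lin_span (segre k n ` S))"

definition min_multiproj ::
    "nat \<Rightarrow> (nat \<Rightarrow> (nat \<Rightarrow> 'a::field) set) set \<Rightarrow> (nat \<Rightarrow> (nat \<Rightarrow> 'a) set) set" where
  "min_multiproj k A = (\<Pi>\<^sub>E i\<in>{..<k}. lin_span ((\<lambda>y. y i) ` A))"

text \<open>The list \<open>[m_1, ..., m_s]\<close> of the dimensions of the positive-dimensional factors
  of the minimal multiprojective space containing \<open>A\<close>, in the order of the factors.\<close>

definition min_multiproj_dims ::
    "nat \<Rightarrow> (nat \<Rightarrow> (nat \<Rightarrow> 'a::field) set) set \<Rightarrow> int list" where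
  "min_multiproj_dims k A =
     filter (\<lambda>m. m > 0) (map (\<lambda>i. pdim (lin_span ((\<lambda>y. y i) ` A))) [0..<k])"

definition nondegenerate ::
    "nat \<Rightarrow> (nat \<Rightarrow> nat) \<Rightarrow> (nat \<Rightarrow> (nat \<Rightarrow> 'a::field) set) set \<Rightarrow> bool" where
  "nondegenerate k n S \<longleftrightarrow> min_multiproj k S = multiproj k n"

definition is_kernel ::
    "nat \<Rightarrow> (nat \<Rightarrow> nat) \<Rightarrow> (nat \<Rightarrow> (nat \<Rightarrow> 'a::field) set) set
      \<Rightarrow> (nat \<Rightarrow> (nat \<Rightarrow> 'a) set) set \<Rightarrow> bool" where
  "is_kernel k n S A \<longleftrightarrow>
     A \<subseteq> S \<and> excess k n A = excess k n S \<and> (\<forall>B. B \<subset> A \<longrightarrow> excess k n B \<noteq> excess k n S)"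

text \<open>Nondegenerate \<open>S\<close> in \<open>Y = P^(n_1) x ... x P^(n_k)\<close> (indices shifted to \<open>i < k\<close>)
  with \<open>#(S) = 5\<close>, \<open>e(S) \<ge> 2\<close> and kernel \<open>A\<close>.\<close>

definition five_point_setup ::
    "nat \<Rightarrow> (nat \<Rightarrow> nat) \<Rightarrow> (nat \<Rightarrow> (nat \<Rightarrow> 'a::field) set) set
      \<Rightarrow> (nat \<Rightarrow> (nat \<Rightarrow> 'a) set) set \<Rightarrow> bool" where
  "five_point_setup k n S A \<longleftrightarrow>
     k \<ge> 1 \<and> (\<forall>i<k. n i > 0) \<and> S \<subseteq> multiproj k n \<and> nondegenerate k n S \<and>
     card S = 5 \<and> excess k n S \<ge> 2 \<and> is_kernel k n S A"


lemma card_multi_idx: "card (multi_idx k n) = (\<Prod>i<k. n i + 1)"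
  by (simp add: multi_idx_def card_PiE)

lemma subspace_coord_space: "fvs.subspace (coord_space I)"
  by (auto simp: fvs.subspace_def coord_space_def fscale_def)

lemma Union_proj_of:
  assumes "fvs.subspace W"
  shows "insert 0 (\<Union>(proj_of W)) = W"
proof -
  have "x \<in> W" if "L \<in> proj_of W" "x \<in> L" for L x
  proof -
    from that(1) obtain v where v: "v \<in> W" "L = fvs.span {v}"
      by (auto simp: proj_of_def)
    then have "L \<subseteq> W" using assms by (simp add: fvs.span_minimal)
    with that(2) show ?thesis by blast
  qed
  moreover have "0 \<in> W" using assms by (rule fvs.subspace_0)
  moreover have "x \<in> \<Union>(proj_of W)" if "x \<in> W" "x \<noteq> 0" for x
  proof
    show "fvs.span {x} \<in> proj_of W" using that unfolding proj_of_def by blast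
    show "x \<in> fvs.span {x}" by (rule fvs.span_base) simp
  qed
  ultimately show ?thesis by blast
qed

lemma pdim_proj_of:
  assumes "fvs.subspace W"
  shows "pdim (proj_of W) = int (fvs.dim W) - 1"
proof -
  have "fvs.span (\<Union>(proj_of W)) = fvs.span W"
    using Union_proj_of[OF assms] fvs.span_insert_0 by metis
  then show ?thesis
    unfolding pdim_def by (metis fvs.dim_span)
qed

lemma pdim_lin_span: "pdim (lin_span T) = int (fvs.dim (\<Union>T)) - 1"
  unfolding lin_span_def by (simp add: pdim_proj_of fvs.subspace_span fvs.dim_span)

lemma dim_coord_space:
  assumes "finite I"
  shows "fvs.dim (coord_space I :: ('i \<Rightarrow> 'a::field) set) = card I"
proof -
  define u :: "'i \<Rightarrow> 'i \<Rightarrow> 'a" where "u = (\<lambda>i j. if j = i then 1 else 0)"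
  have inj: "inj u"
  proof (rule injI)
    fix i j assume "u i = u j"
    then have "u i i = u j i" by (rule fun_cong)
    then show "i = j" by (simp add: u_def split: if_splits)
  qed
  have sum_u: "(\<Sum>i\<in>J. fscale (c i) (u i)) j = (if j \<in> J then c j else 0)"
    if "finite J" for c J j
    using that by (induction J) (auto simp: fscale_def u_def)
  have "u ` I \<subseteq> coord_space I"
    by (auto simp: u_def coord_space_def)
  moreover have "coord_space I \<subseteq> fvs.span (u ` I)"
  proof
    fix f :: "'i \<Rightarrow> 'a" assume "f \<in> coord_space I"
    then have "f = (\<Sum>i\<in>I. fscale (f i) (u i))"
      by (auto simp: fun_eq_iff sum_u[OF assms] coord_space_def)
    also have "\<dots> \<in> fvs.span (u ` I)"
      by (intro fvs.span_sum fvs.span_scale fvs.span_base) auto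
    finally show "f \<in> fvs.span (u ` I)" .
  qed
  moreover have "fvs.independent (u ` I)"
  proof (rule fvs.independent_if_scalars_zero)
    show "finite (u ` I)" using assms by simp
    fix c x
    assume eq: "(\<Sum>x\<in>u ` I. fscale (c x) x) = 0" and "x \<in> u ` I"
    then obtain i where i: "i \<in> I" "x = u i" by auto
    have "(\<Sum>i\<in>I. fscale (c (u i)) (u i)) = 0"
      using eq by (simp add: sum.reindex[OF inj_on_subset[OF inj subset_UNIV]])
    then have "(\<Sum>i\<in>I. fscale (c (u i)) (u i)) i = 0" by simp
    then show "c x = 0" using i by (simp add: sum_u[OF assms])
  qed
  ultimately have "fvs.dim (coord_space I :: ('i \<Rightarrow> 'a) set) = card (u ` I)"
    by (intro fvs.dim_unique) auto
  also have "\<dots> = card I"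
    by (intro card_image inj_on_subset[OF inj]) auto
  finally show ?thesis .
qed

lemma pdim_proj_space: "pdim (proj_space n :: (nat \<Rightarrow> 'a::field) set set) = int n"
  unfolding proj_space_def
  by (simp add: pdim_proj_of subspace_coord_space dim_coord_space)

lemma segre_point:
  "segre k n (\<lambda>i\<in>{..<k}. fvs.span {v i}) = fvs.span {tensor k n v}"
proof -
  have "\<exists>c. tensor k n w = fscale c (tensor k n v)" if "\<forall>i<k. w i \<in> fvs.span {v i}" for w
  proof -
    have "\<forall>i\<in>{..<k}. \<exists>c. w i = fscale c (v i)"
      using that by (auto simp: fvs.span_singleton)
    then obtain c where "\<forall>i\<in>{..<k}. w i = fscale (c i) (v i)" by metis
    then have "tensor k n w = fscale (\<Prod>i<k. c i) (tensor k n v)"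
      by (auto simp: tensor_def fscale_def fun_eq_iff prod.distrib intro!: prod.cong)
    then show ?thesis ..
  qed
  then have "{tensor k n w | w. \<forall>i<k. w i \<in> fvs.span {v i}} \<subseteq> fvs.span {tensor k n v}"
    by (fastforce simp: fvs.span_singleton)
  moreover have "tensor k n v \<in> {tensor k n w | w. \<forall>i<k. w i \<in> fvs.span {v i}}"
    using fvs.span_base[of _ "{_}"] by blast
  ultimately have "fvs.span {tensor k n w | w. \<forall>i<k. w i \<in> fvs.span {v i}}
      = fvs.span {tensor k n v}"
    by (intro antisym fvs.span_minimal fvs.span_mono fvs.subspace_span) auto
  then show ?thesis by (simp add: segre_def)
qed

end

theory Submission
  imports Defs
begin

text \<open>A linear relation among the Segre images of some points can be contracted with a linear form
  on one factor: the points killed by the form drop out, and a relation with smaller support on the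
  remaining factors is left. Hence a relation never has a single term, two points in a relation are
  equal, three points in a relation differ in one factor only, and four points in a relation differ
  in at most two factors if their projections to each factor lie on a line. If the span of \<open>\<nu>(S)\<close> is a line, or if \<open>S\<close>
  contains four points with collinear images, then all the points concerned vary in a single factor,
  whose projection spans a line. Otherwise the span is a plane and every point of \<open>S\<close> is involved in
  a relation; a factor in which \<open>S\<close> spans a plane is the only one, and if there is no such factor,
  then combining two relations with small supports shows that \<open>S\<close> varies in at most two factors.\<close>

section \<open>Relations among decomposable tensors\<close>

text \<open>The field may have only two elements, and this shapes the proof: a form that vanishes at
  one point may be forced to vanish at others, so no general-position choices are available. What
  survives over every field is that two distinct points are separated by a form, and this is what
  \<open>separating\<close> records. When the projection of \<open>S\<close> to a factor spans a
  line, a form can vanish at exactly one of its points; when it spans more, a dual basis of forms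
  takes over. \<open>multi_rel\<close> tests a relation on products of forms, one for each factor in
  \<open>I\<close>, so that contraction only shrinks \<open>I\<close> and changes coefficients,
  while the terms stay indexed by the original points. The case distinction comes from
  \<open>excess\<close> being cardinality minus vector-space rank: five points of excess at least 2
  have rank 2 or 3. If the rank is 3 and the kernel is \<open>S\<close>, minimality says that
  removing any point leaves rank 3, which yields for each point both a relation through it and one
  avoiding it. The bounds 4 and 3 on the field size occur because a line over a field with q
  elements has q + 1 points.\<close>

definition multi_rel ::
    "('q \<Rightarrow> 'a::field) set \<Rightarrow> 'i set \<Rightarrow> ('i \<Rightarrow> 'q) set \<Rightarrow> (('i \<Rightarrow> 'q) \<Rightarrow> 'a) \<Rightarrow> bool" where
  "multi_rel F I S c \<longleftrightarrow>
     (\<forall>f. (\<forall>i\<in>I. f i \<in> F) \<longrightarrow> (\<Sum>y\<in>S. c y * (\<Prod>i\<in>I. f i (y i))) = 0)"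

definition agree_at :: "('i \<Rightarrow> 'q) set \<Rightarrow> 'i \<Rightarrow> bool" where
  "agree_at S i \<longleftrightarrow> (\<forall>y\<in>S. \<forall>z\<in>S. y i = z i)"

lemma agree_atD: "agree_at S i \<Longrightarrow> y \<in> S \<Longrightarrow> z \<in> S \<Longrightarrow> y i = z i"
  by (auto simp: agree_at_def)

lemma agree_atI: "(\<And>y. y \<in> S \<Longrightarrow> y i = p) \<Longrightarrow> agree_at S i"
  by (auto simp: agree_at_def)

lemma agree_at_Un:
  assumes "agree_at S i" "agree_at T i" "S \<inter> T \<noteq> {}"
  shows "agree_at (S \<union> T) i"
proof -
  obtain x where x: "x \<in> S" "x \<in> T" using assms(3) by auto
  have "y i = x i" if "y \<in> S \<union> T" for y
    using that x assms(1,2) by (auto simp: agree_at_def)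
  then show ?thesis unfolding agree_at_def by metis
qed

text \<open>Fixing the form in slot \<open>i\<close> to be \<open>g\<close> moves the scalar
  \<open>g (y i)\<close> into the coefficient, so the points where \<open>g\<close> vanishes leave
  the support.\<close>

lemma multi_rel_contract:
  assumes "multi_rel F I S c" "finite I" "i \<in> I" "g \<in> F"
  shows "multi_rel F (I - {i}) S (\<lambda>y. c y * g (y i))"
  unfolding multi_rel_def
proof (intro allI impI)
  fix f assume f: "\<forall>m\<in>I - {i}. f m \<in> F"
  have "(\<Prod>m\<in>I. (f(i := g)) m (y m)) = g (y i) * (\<Prod>m\<in>I - {i}. f m (y m))" for y
    using assms(2,3) by (subst prod.remove[of _ i]) (auto intro!: prod.cong)
  moreover have "(\<Sum>y\<in>S. c y * (\<Prod>m\<in>I. (f(i := g)) m (y m))) = 0"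
    by (rule assms(1)[unfolded multi_rel_def, rule_format]) (use assms(4) f in auto)
  ultimately show "(\<Sum>y\<in>S. c y * g (y i) * (\<Prod>m\<in>I - {i}. f m (y m))) = 0"
    by (simp add: mult.assoc)
qed

text \<open>\<open>F\<close> stands for linear forms evaluated at representatives, \<open>Q\<close>
  for the points of a projective space.\<close>

locale separating =
  fixes F :: "('q \<Rightarrow> 'a::field) set" and Q :: "'q set"
  assumes sep: "\<And>p q. p \<in> Q \<Longrightarrow> q \<in> Q \<Longrightarrow> p \<noteq> q \<Longrightarrow> \<exists>f\<in>F. f p = 0 \<and> f q \<noteq> 0"
    and nonvanishing: "\<And>q. q \<in> Q \<Longrightarrow> \<exists>f\<in>F. f q \<noteq> 0"
begin

text \<open>A functional that kills \<open>p\<close> but not \<open>a i\<close> would isolate the term of \<open>a\<close> in the relation.\<close>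

lemma isolated:
  assumes "multi_rel F I S c" "finite I" "finite S" "\<forall>y\<in>S. \<forall>j\<in>I. y j \<in> Q"
    and a: "a \<in> S" "c a \<noteq> 0" and i: "i \<in> I" "p \<in> Q"
    and others: "\<And>y. y \<in> S \<Longrightarrow> y \<noteq> a \<Longrightarrow> c y \<noteq> 0 \<Longrightarrow> y i = p"
  shows "a i = p"
proof (rule ccontr)
  assume "a i \<noteq> p"
  then obtain g where g: "g \<in> F" "g p = 0" "g (a i) \<noteq> 0"
    using sep[of p "a i"] assms(4) a i by metis
  have "\<exists>h\<in>F. h (a m) \<noteq> 0" if "m \<in> I" for m
    using nonvanishing assms(4) a that by blast
  then obtain h where h: "\<And>m. m \<in> I \<Longrightarrow> h m \<in> F \<and> h m (a m) \<noteq> 0" by metis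
  define f where "f = h(i := g)"
  have f: "\<forall>m\<in>I. f m \<in> F" "\<forall>m\<in>I. f m (a m) \<noteq> 0" using h g by (auto simp: f_def)
  have "c y * (\<Prod>m\<in>I. f m (y m)) = 0" if "y \<in> S - {a}" for y
  proof (cases "c y = 0")
    case False
    then have "f i (y i) = 0" using others that g by (auto simp: f_def)
    then show ?thesis using i assms(2) by auto
  qed simp
  then have "(\<Sum>y\<in>S - {a}. c y * (\<Prod>m\<in>I. f m (y m))) = 0"
    by (rule sum.neutral[rule_format])
  then have "(\<Sum>y\<in>S. c y * (\<Prod>m\<in>I. f m (y m))) = c a * (\<Prod>m\<in>I. f m (a m))"
    using assms(3) a by (subst sum.remove[of _ a]) simp_all
  then show False using assms(1,2) f a unfolding multi_rel_def by auto
qed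

text \<open>A product of forms that do not vanish at \<open>a\<close> evaluates the relation to a
  nonzero multiple of \<open>c a\<close>. If \<open>I\<close> is empty the product is 1; this case
  is reached when the only factor has been contracted.\<close>

lemma no_singleton_relation:
  assumes "multi_rel F I S c" "finite I" "finite S" "\<forall>y\<in>S. \<forall>j\<in>I. y j \<in> Q"
    and a: "a \<in> S" and others: "\<And>y. y \<in> S \<Longrightarrow> y \<noteq> a \<Longrightarrow> c y = 0"
  shows "c a = 0"
proof (rule ccontr)
  assume "c a \<noteq> 0"
  have "\<exists>h\<in>F. h (a m) \<noteq> 0" if "m \<in> I" for m
    using nonvanishing assms(4) a that by blast
  then obtain f where f: "\<And>m. m \<in> I \<Longrightarrow> f m \<in> F \<and> f m (a m) \<noteq> 0" by metis
  have "(\<Sum>y\<in>S. c y * (\<Prod>m\<in>I. f m (y m))) = c a * (\<Prod>m\<in>I. f m (a m))"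
    using assms(3) a others by (subst sum.remove[of _ a]) auto
  then show False using assms(1,2) f \<open>c a \<noteq> 0\<close> unfolding multi_rel_def by auto
qed

lemma relation_two:
  assumes "multi_rel F I S c" "finite I" "finite S" "\<forall>y\<in>S. \<forall>j\<in>I. y j \<in> Q"
    and "a \<in> S" "b \<in> S" "c a \<noteq> 0" and "\<And>y. y \<in> S \<Longrightarrow> y \<noteq> a \<Longrightarrow> y \<noteq> b \<Longrightarrow> c y = 0"
    and "i \<in> I"
  shows "a i = b i"
  by (rule isolated[where c = c and a = a and i = i and p = "b i", OF assms(1-4,5,7,9)]) (use assms in auto)

text \<open>In a factor where the points do not all agree, \<open>b\<close> agrees with neither of
  the others, since the third point would then be isolated. Killing \<open>a\<close>, and likewise
  \<open>d\<close>, leaves a relation between the remaining two points, which must agree in all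
  other factors.\<close>

lemma relation_three:
  assumes rel: "multi_rel F I S c" and fin: "finite I" "finite S"
    and Q: "\<forall>y\<in>S. \<forall>j\<in>I. y j \<in> Q"
    and supp: "{y \<in> S. c y \<noteq> 0} = {a, b, d}"
  shows "\<exists>j. \<forall>i\<in>I - {j}. agree_at {a, b, d} i"
proof (cases "\<forall>i\<in>I. agree_at {a, b, d} i")
  case False
  have mem: "a \<in> S" "b \<in> S" "d \<in> S" "c a \<noteq> 0" "c b \<noteq> 0" "c d \<noteq> 0"
    and zero: "\<And>y. y \<in> S \<Longrightarrow> y \<notin> {a, b, d} \<Longrightarrow> c y = 0"
    using supp by auto
  obtain i where i: "i \<in> I" "\<not> agree_at {a, b, d} i" using False by blast
  have iso: "x i = p" if "x \<in> {a, b, d}" "\<And>y. y \<in> {a, b, d} - {x} \<Longrightarrow> y i = p" "p \<in> Q" for x p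
    by (rule isolated[where c = c and a = x and i = i and p = p, OF rel fin Q _ _ i(1) that(3)]) (use that zero mem in auto)
  have Qi: "a i \<in> Q" "b i \<in> Q" "d i \<in> Q" using Q mem i by auto
  have ab: "a i \<noteq> b i"
  proof
    assume eq: "a i = b i"
    have "d i = b i" by (rule iso) (use eq Qi in auto)
    then show False using eq i(2) by (simp add: agree_at_def)
  qed
  have db: "d i \<noteq> b i"
  proof
    assume eq: "d i = b i"
    have "a i = b i" by (rule iso) (use eq Qi in auto)
    then show False using eq i(2) by (simp add: agree_at_def)
  qed
  have step: "y m = z m"
    if m: "m \<in> I - {i}" and xyz: "{a, b, d} = {x, y, z}" and ne: "x i \<noteq> y i" for x y z m
  proof -
    have xy: "x \<in> {a, b, d}" "y \<in> {a, b, d}" "z \<in> {a, b, d}" using xyz by auto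
    then obtain g where g: "g \<in> F" "g (x i) = 0" "g (y i) \<noteq> 0"
      using sep[of "x i" "y i"] ne Qi by blast
    show ?thesis
    proof (rule relation_two[where a = y and b = z, OF multi_rel_contract[OF rel fin(1) i(1) g(1)]])
      fix w assume "w \<in> S" "w \<noteq> y" "w \<noteq> z"
      then show "c w * g (w i) = 0" using g zero xyz by (cases "w = x") auto
    qed (use fin Q xy mem g m in auto)
  qed
  have "agree_at {a, b, d} m" if "m \<in> I - {i}" for m
  proof -
    have "b m = d m" by (rule step[OF that, of a]) (use ab in auto)
    moreover have "b m = a m"
      by (rule step[OF that, of d]) (use db in auto)
    ultimately show ?thesis by (simp add: agree_at_def)
  qed
  then show ?thesis by blast
qed auto

text \<open>The assumption \<open>kill\<close> holds for points on a line; in a plane over a small field, a form that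
  vanishes at \<open>x i\<close> may be forced to vanish at other points as well.\<close>

lemma relation_four:
  assumes rel: "multi_rel F I S c" and fin: "finite I" "finite S"
    and Q: "\<forall>y\<in>S. \<forall>j\<in>I. y j \<in> Q"
    and distinct: "\<And>y z. y \<in> S \<Longrightarrow> z \<in> S \<Longrightarrow> (\<And>i. i \<in> I \<Longrightarrow> y i = z i) \<Longrightarrow> y = z"
    and kill: "\<forall>x\<in>S. \<forall>i\<in>I. \<exists>g\<in>F. \<forall>y\<in>S. g (y i) = 0 \<longleftrightarrow> y i = x i"
    and supp: "{y \<in> S. c y \<noteq> 0} = T" "card T = 4"
  shows "\<exists>i j. \<forall>m\<in>I - {i, j}. agree_at T m"
proof (cases "\<forall>i\<in>I. agree_at T i")
  case False
  then obtain i where i: "i \<in> I" "\<not> agree_at T i" by blast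
  have T: "T \<subseteq> S" "finite T" "\<And>y. y \<in> T \<Longrightarrow> c y \<noteq> 0" "\<And>y. y \<in> S \<Longrightarrow> y \<notin> T \<Longrightarrow> c y = 0"
    using supp(1) fin by auto
  obtain a b where ab: "a \<in> T" "b \<in> T" "a i \<noteq> b i" using i by (auto simp: agree_at_def)
  have "card (T - {a, b}) = card T - card {a, b}" using ab by (intro card_Diff_subset) auto
  moreover have "a \<noteq> b" using ab by auto
  ultimately have "card (T - {a, b}) = 2" using supp(2) by simp
  then obtain d e where de: "T - {a, b} = {d, e}" "d \<noteq> e" by (auto simp: card_2_iff)
  have Teq: "T = {a, b, d, e}" and dist: "distinct [a, b, d, e]"
    using de ab by auto
  have iso: "x m = p" if "m \<in> I" "x \<in> T" "\<And>y. y \<in> T - {x} \<Longrightarrow> y m = p" "p \<in> Q" for x p m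
    by (rule isolated[where c = c and a = x and i = m and p = p, OF rel fin Q _ _ that(1,4)]) (use that T in auto)
  text \<open>A partition into two classes of size two is impossible, since the two points of either
    class would agree everywhere.\<close>
  have no22: "\<not> (x i = y i \<and> z i = w i)" if Txy: "T = {x, y, z, w}" "distinct [x, y, z, w]" for x y z w
  proof
    assume eq: "x i = y i \<and> z i = w i"
    have mem: "x \<in> S" "y \<in> S" "z \<in> S" "w \<in> S" using that T by auto
    have "x i \<noteq> z i"
    proof
      assume "x i = z i"
      then have "agree_at T i" using eq that by (auto simp: agree_at_def)
      then show False using i by simp
    qed
    then obtain g where g: "g \<in> F" "g (x i) = 0" "g (z i) \<noteq> 0"
      using sep[of "x i" "z i"] Q mem i by blast
    have "z m = w m" if m: "m \<in> I - {i}" for m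
    proof (rule relation_two[where a = z and b = w, OF multi_rel_contract[OF rel fin(1) i(1) g(1)]])
      fix u assume "u \<in> S" "u \<noteq> z" "u \<noteq> w"
      then show "c u * g (u i) = 0" using g eq T(4) Txy(1) by (cases "u \<in> T") auto
    qed (use fin Q mem g m T(3)[of z] Txy(1) in auto)
    then have "z = w" using distinct mem eq by blast
    then show False using that by simp
  qed
  \<comment> \<open>If every point of \<open>T\<close> shared its entry at \<open>i\<close> with
    another one, then \<open>a\<close> and \<open>b\<close> having different entries would leave
    only a partition into two pairs, which \<open>no22\<close> excludes. So some \<open>x\<close>
    stands alone.\<close>
  have "\<exists>x\<in>T. \<forall>y\<in>T - {x}. y i \<noteq> x i"
  proof (rule ccontr)
    assume contra: "\<not> ?thesis"
    have ex: "\<exists>y\<in>T - {x}. y i = x i" if "x \<in> T" for x using contra that by auto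
    have Qi: "\<And>x. x \<in> T \<Longrightarrow> x i \<in> Q" using Q T(1) i(1) by blast
    have p1: "T = {a, d, b, e}" "T = {a, e, b, d}" using Teq by auto
    have "a i = d i \<or> a i = e i" "b i = d i \<or> b i = e i"
      using ex[of a] ex[of b] ab dist unfolding Teq by auto
    then show False
      using no22[OF p1(1)] no22[OF p1(2)] dist ab(3) by auto
  qed
  then obtain x where x: "x \<in> T" "\<And>y. y \<in> T - {x} \<Longrightarrow> y i \<noteq> x i" by blast
  have "card (T - {x}) = 3" using x supp(2) T(2) by simp
  then obtain u v w where uvw: "T - {x} = {u, v, w}" by (auto simp: card_3_iff)
  have u: "u \<in> T" "u \<noteq> x" using uvw by auto
  have "x \<in> S" using x(1) T(1) by auto
  \<comment> \<open>The form must vanish at \<open>x\<close> and at no other point of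
    \<open>T\<close>, so that the contracted relation has exactly three terms, as
    \<open>relation_three\<close> requires.\<close>
  with kill i(1) have "\<exists>g\<in>F. \<forall>y\<in>S. g (y i) = 0 \<longleftrightarrow> y i = x i" by simp
  then
  obtain g where g: "g \<in> F" "\<forall>y\<in>S. g (y i) = 0 \<longleftrightarrow> y i = x i" by (elim bexE) auto
  have "{y \<in> S. c y * g (y i) \<noteq> 0} = {u, v, w}"
    using supp(1) x g unfolding uvw[symmetric] by auto
  then have "\<exists>j. \<forall>m\<in>I - {i} - {j}. agree_at {u, v, w} m"
    using relation_three[OF multi_rel_contract[OF rel fin(1) i(1) g(1)]] fin Q by simp
  then obtain j where j: "\<And>m. m \<in> I - {i, j} \<Longrightarrow> agree_at {u, v, w} m" by auto
  have "agree_at T m" if m: "m \<in> I - {i, j}" for m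
  proof -
    have eq: "y m = u m" if "y \<in> T - {x}" for y
      by (rule agree_atD[OF j[OF m]]) (use that uvw in auto)
    have "u m \<in> Q" using Q m u(1) T(1) by blast
    \<comment> \<open>Contraction has removed \<open>x\<close>; the original relation brings it
      back, since \<open>x\<close> cannot be isolated in factor \<open>m\<close>.\<close>
    then have "x m = u m" using iso[of m x "u m"] eq m x(1) by blast
    with eq have "y m = u m" if "y \<in> T" for y
      using that by (cases "y = x") auto
    then show ?thesis by (rule agree_atI)
  qed
  then show ?thesis by blast
qed auto

text \<open>A single term is impossible, and two terms would identify two distinct points. In terms
  of vectors, distinct points have nonproportional tensors.\<close>

lemma support_ge_three:
  assumes rel: "multi_rel F I S c" and fin: "finite I" "finite S"
    and Q: "\<forall>y\<in>S. \<forall>j\<in>I. y j \<in> Q"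
    and distinct: "\<And>y z. y \<in> S \<Longrightarrow> z \<in> S \<Longrightarrow> (\<And>i. i \<in> I \<Longrightarrow> y i = z i) \<Longrightarrow> y = z"
    and a: "a \<in> S" "c a \<noteq> 0"
  shows "card {y \<in> S. c y \<noteq> 0} \<ge> 3"
proof (rule ccontr)
  let ?T = "{y \<in> S. c y \<noteq> 0}"
  assume "\<not> ?thesis"
  moreover have "card ?T \<noteq> 0" using a fin by auto
  ultimately consider "card ?T = 1" | "card ?T = 2" by linarith
  then show False
  proof cases
    case 1
    then obtain x where "?T = {x}" by (auto simp: card_1_singleton_iff)
    then have "c y = 0" if "y \<in> S" "y \<noteq> a" for y
      using that a by (metis (mono_tags, lifting) mem_Collect_eq singletonD)
    then have "c a = 0" by (rule no_singleton_relation[OF rel fin Q a(1)])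
    then show False using a by simp
  next
    case 2
    then obtain x y where xy: "?T = {x, y}" "x \<noteq> y" by (auto simp: card_2_iff)
    then have mem: "x \<in> S" "y \<in> S" "c x \<noteq> 0" "\<And>z. z \<in> S \<Longrightarrow> z \<noteq> x \<Longrightarrow> z \<noteq> y \<Longrightarrow> c z = 0"
      by auto
    then have "x i = y i" if "i \<in> I" for i
      by (rule relation_two[OF rel fin Q]) (use mem that in auto)
    then show False using distinct[OF mem(1,2)] xy(2) by simp
  qed
qed

text \<open>If \<open>T\<close> misses a point \<open>z\<close>, then a relation through
  \<open>z\<close> has all its other terms in \<open>T\<close>, where factor \<open>m\<close> is
  constant, so \<open>isolated\<close> forces \<open>z\<close> to agree as well.\<close>

lemma agree_extend:
  assumes fin: "finite I" and S: "card S = 5"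
    and Q: "\<forall>y\<in>S. \<forall>j\<in>I. y j \<in> Q"
    and through: "\<And>a. a \<in> S \<Longrightarrow> \<exists>c. multi_rel F I S c \<and> c a \<noteq> 0"
    and m: "m \<in> I" and T: "T \<subseteq> S" "4 \<le> card T" "agree_at T m"
  shows "agree_at S m"
proof (cases "T = S")
  case False
  have finS: "finite S" using S card.infinite by force
  obtain z where z: "z \<in> S" "z \<notin> T" using T False by auto
  have "card (S - {z}) = 4" using z S finS by simp
  then have Teq: "T = S - {z}"
    using T z finS by (intro card_seteq) auto
  obtain w where w: "w \<in> T" using T(2) by fastforce
  obtain c where c: "multi_rel F I S c" "c z \<noteq> 0" using through z by blast
  have "w m \<in> Q" using Q T w m by auto
  then have "z m = w m"
    by (rule isolated[OF c(1) fin finS Q z(1) c(2) m])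
      (use agree_atD[OF T(3) _ w] Teq in auto)
  then show ?thesis using T(3) w z Teq unfolding agree_at_def by (metis DiffI singletonD)
qed (use T in auto)

text \<open>A relation avoiding a point has three or four terms. Four terms vary in at most two
  factors, and the fifth point follows by \<open>agree_extend\<close>. If only triples occur, two of
  them that overlap suffice, since each varies in at most one factor.\<close>

lemma five_points:
  assumes fin: "finite I" and S: "card S = 5"
    and Q: "\<forall>y\<in>S. \<forall>j\<in>I. y j \<in> Q"
    and distinct: "\<And>y z. y \<in> S \<Longrightarrow> z \<in> S \<Longrightarrow> (\<And>i. i \<in> I \<Longrightarrow> y i = z i) \<Longrightarrow> y = z"
    and kill: "\<forall>x\<in>S. \<forall>i\<in>I. \<exists>g\<in>F. \<forall>y\<in>S. g (y i) = 0 \<longleftrightarrow> y i = x i"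
    and through: "\<And>a. a \<in> S \<Longrightarrow> \<exists>c. multi_rel F I S c \<and> c a \<noteq> 0"
    and avoiding: "\<And>a. a \<in> S \<Longrightarrow> \<exists>c. multi_rel F I (S - {a}) c \<and> (\<exists>y\<in>S - {a}. c y \<noteq> 0)"
  shows "\<exists>i j. \<forall>m\<in>I - {i, j}. agree_at S m"
proof -
  have finS: "finite S" using S card.infinite by force
  note extend = agree_extend[OF fin S Q through]
  have small: "(\<exists>T\<subseteq>S - {a}. card T = 4 \<and> (\<exists>i j. \<forall>m\<in>I - {i, j}. agree_at T m)) \<or>
      (\<exists>T\<subseteq>S - {a}. card T = 3 \<and> (\<exists>j. \<forall>m\<in>I - {j}. agree_at T m))" if a: "a \<in> S" for a
  proof -
    obtain c x where c: "multi_rel F I (S - {a}) c" and x: "x \<in> S - {a}" "c x \<noteq> 0"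
      using avoiding a by blast
    define T where "T = {y \<in> S - {a}. c y \<noteq> 0}"
    have fin': "finite (S - {a})" "\<forall>y\<in>S - {a}. \<forall>j\<in>I. y j \<in> Q" using finS Q by auto
    have dist': "y = z" if "y \<in> S - {a}" "z \<in> S - {a}" "\<And>i. i \<in> I \<Longrightarrow> y i = z i" for y z
      by (rule distinct) (use that in auto)
    have kill': "\<forall>x\<in>S - {a}. \<forall>i\<in>I. \<exists>g\<in>F. \<forall>y\<in>S - {a}. g (y i) = 0 \<longleftrightarrow> y i = x i"
    proof (intro ballI)
      fix x i assume "x \<in> S - {a}" "i \<in> I"
      with kill have "\<exists>g\<in>F. \<forall>y\<in>S. g (y i) = 0 \<longleftrightarrow> y i = x i" by simp
      then show "\<exists>g\<in>F. \<forall>y\<in>S - {a}. g (y i) = 0 \<longleftrightarrow> y i = x i" by (elim bexE) auto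
    qed
    have "card T \<ge> 3"
      unfolding T_def by (rule support_ge_three[OF c fin fin' dist' x])
    moreover have "card T \<le> card (S - {a})" by (rule card_mono) (use fin' in \<open>auto simp: T_def\<close>)
    moreover have "card (S - {a}) = 4" using S a finS by simp
    ultimately consider "card T = 4" | "card T = 3" by linarith
    then show ?thesis
    proof cases
      case 1
      have "\<exists>i j. \<forall>m\<in>I - {i, j}. agree_at T m"
        by (rule relation_four[where c = c, OF c fin fin' dist' kill' T_def[symmetric] 1])
      moreover have "T \<subseteq> S - {a}" by (auto simp: T_def)
      ultimately show ?thesis using 1 by blast
    next
      case 2
      then obtain u v w where uvw: "T = {u, v, w}" by (auto simp: card_3_iff)
      then have "\<exists>j. \<forall>m\<in>I - {j}. agree_at T m"
        using relation_three[OF c fin fin'] T_def by simp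
      moreover have "T \<subseteq> S - {a}" by (auto simp: T_def)
      ultimately show ?thesis using 2 by blast
    qed
  qed
  show ?thesis
  proof (cases "\<exists>T\<subseteq>S. card T = 4 \<and> (\<exists>i j. \<forall>m\<in>I - {i, j}. agree_at T m)")
    case True
    then obtain T i j where T: "T \<subseteq> S" "card T = 4" "\<And>m. m \<in> I - {i, j} \<Longrightarrow> agree_at T m"
      by blast
    have "agree_at S m" if "m \<in> I - {i, j}" for m
      by (rule extend[OF _ _ T(1)]) (use T that in auto)
    then show ?thesis by blast
  next
    case False
    have three: "\<exists>T\<subseteq>S - {a}. card T = 3 \<and> (\<exists>j. \<forall>m\<in>I - {j}. agree_at T m)" if "a \<in> S" for a
      using small[OF that] False by (meson Diff_subset subset_trans)
    obtain a where "a \<in> S" using S by fastforce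
    then obtain T i where T: "T \<subseteq> S" "card T = 3" "\<And>m. m \<in> I - {i} \<Longrightarrow> agree_at T m"
      using three[of a] by auto
    \<comment> \<open>The second triple avoids a point of the first and so differs from it. The
      triples meet because 3 + 3 > 5, and their union has at least 4 points.\<close>
    obtain b where b: "b \<in> T" using T(2) by fastforce
    then have "b \<in> S" using T(1) by auto
    then obtain U j where U: "U \<subseteq> S - {b}" "card U = 3" "\<And>m. m \<in> I - {j} \<Longrightarrow> agree_at U m"
      using three[of b] by auto
    have finTU: "finite T" "finite U" using T U finS finite_subset by blast+
    have "card (T \<union> U) \<le> 5"
      unfolding S[symmetric] by (rule card_mono) (use finS T U in auto)
    then have "T \<inter> U \<noteq> {}"
      using card_Un_Int[OF finTU] T(2) U(2) by auto
    moreover have "card (T \<union> U) \<ge> 4"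
    proof -
      have "card (insert b U) = 4" using U finTU by (subst card_insert_disjoint) auto
      moreover have "card (insert b U) \<le> card (T \<union> U)"
        by (rule card_mono) (use finTU b in auto)
      ultimately show ?thesis by simp
    qed
    ultimately have "agree_at S m" if "m \<in> I - {i, j}" for m
      by (intro extend[of m "T \<union> U"] agree_at_Un) (use T U that in auto)
    then show ?thesis by blast
  qed
qed

text \<open>Contracting with a form dual to \<open>x\<close> leaves only the terms of \<open>x\<close> and of \<open>y\<close>.\<close>

lemma agree_off_basis:
  assumes rel: "multi_rel F I (insert y B) c" and fin: "finite I" "finite B"
    and Q: "\<forall>y\<in>insert y B. \<forall>j\<in>I. y j \<in> Q"
    and i: "i \<in> I" and x: "x \<in> B" "c x \<noteq> 0"
    and d: "d \<in> F" "d (x i) \<noteq> 0" "\<And>z. z \<in> B - {x} \<Longrightarrow> d (z i) = 0"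
    and m: "m \<in> I - {i}"
  shows "x m = y m"
  by (rule relation_two[OF multi_rel_contract[OF rel fin(1) i d(1)]]) (use fin Q x d m in auto)

text \<open>The form dual to \<open>x\<close> contracts the relation to its term at
  \<open>x\<close>. Points whose projections to one factor are independent thus have no nontrivial
  relation.\<close>

lemma no_relation_dual:
  assumes rel: "multi_rel F I B c" and fin: "finite I" "finite B"
    and Q: "\<forall>y\<in>B. \<forall>j\<in>I. y j \<in> Q"
    and i: "i \<in> I" and x: "x \<in> B"
    and d: "d \<in> F" "d (x i) \<noteq> 0" "\<And>z. z \<in> B - {x} \<Longrightarrow> d (z i) = 0"
  shows "c x = 0"
proof -
  have "c x * d (x i) = 0"
    by (rule no_singleton_relation[OF multi_rel_contract[OF rel fin(1) i d(1)]])
      (use fin Q x d in auto)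
  then show ?thesis using d by simp
qed

end

section \<open>Ranks of finite sets of points\<close>

lemma dim_mono_finite:
  fixes V W :: "('i \<Rightarrow> 'a::field) set"
  assumes "finite W" "V \<subseteq> fvs.span W"
  shows "fvs.dim V \<le> fvs.dim W"
proof -
  obtain B where B: "B \<subseteq> W" "W \<subseteq> fvs.span B" "card B = fvs.dim W"
    by (rule fvs.basis_exists)
  have "V \<subseteq> fvs.span B"
    using assms(2) fvs.span_minimal[OF B(2) fvs.subspace_span] by (rule subset_trans)
  then have "fvs.dim V \<le> card B"
    using B(1) assms(1) by (intro fvs.dim_le_card) (auto intro: finite_subset)
  then show ?thesis using B(3) by simp
qed

lemma dim_Union_lines: "fvs.dim (\<Union>x\<in>B. fvs.span {f x}) = fvs.dim (f ` B)"
proof (rule fvs.span_eq_dim, rule antisym)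
  show "fvs.span (\<Union>x\<in>B. fvs.span {f x}) \<subseteq> fvs.span (f ` B)"
    by (intro fvs.span_minimal fvs.subspace_span UN_least fvs.span_mono) auto
  show "fvs.span (f ` B) \<subseteq> fvs.span (\<Union>x\<in>B. fvs.span {f x})"
    by (intro fvs.span_mono) (auto intro: fvs.span_base)
qed

lemma sum_fun_apply: "(\<Sum>y\<in>B. f y) x = (\<Sum>y\<in>B. f y x)"
  by (induction B rule: infinite_finite_induct) auto

section \<open>Coordinates and linear forms\<close>

definition coord_unit :: "'i \<Rightarrow> 'i \<Rightarrow> 'a::field" where
  "coord_unit i = (\<lambda>j. if j = i then 1 else 0)"

lemma coord_space_expansion:
  fixes x :: "'i \<Rightarrow> 'a::field"
  assumes "finite I" "x \<in> coord_space I"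
  shows "x = (\<Sum>j\<in>I. fscale (x j) (coord_unit j))"
proof
  fix m
  have "(\<Sum>j\<in>I. fscale (x j) (coord_unit j)) m = (\<Sum>j\<in>I. if m = j then x j else 0)"
    by (simp add: sum_fun_apply fscale_def coord_unit_def cong: sum.cong)
      (auto intro!: sum.cong)
  also have "\<dots> = x m" using assms by (auto simp: coord_space_def)
  finally show "x m = (\<Sum>j\<in>I. fscale (x j) (coord_unit j)) m" by simp
qed

definition linear_form :: "(('i \<Rightarrow> 'a::field) \<Rightarrow> 'a) \<Rightarrow> bool" where
  "linear_form g \<longleftrightarrow> (\<forall>x y. g (x + y) = g x + g y) \<and> (\<forall>c x. g (fscale c x) = c * g x)"

lemma linear_form_0: "linear_form g \<Longrightarrow> g 0 = 0"
  unfolding linear_form_def by (metis add_cancel_right_right)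

lemma linear_form_sum:
  assumes "linear_form g"
  shows "g (\<Sum>y\<in>B. f y) = (\<Sum>y\<in>B. g (f y))"
proof (induction B rule: infinite_finite_induct)
  case (insert y B)
  have "g (f y + sum f B) = g (f y) + g (sum f B)"
    using assms unfolding linear_form_def by blast
  then show ?case by (simp only: sum.insert[OF insert.hyps] insert.IH)
qed (simp_all only: sum.infinite sum.empty linear_form_0[OF assms] not_False_eq_True)

lemma linear_form_extend:
  fixes h :: "('i \<Rightarrow> 'a::field) \<Rightarrow> 'a"
  assumes "fvs.independent B"
  shows "\<exists>g. linear_form g \<and> (\<forall>x\<in>B. g x = h x)"
proof -
  interpret vector_space_pair "fscale :: 'a \<Rightarrow> ('i \<Rightarrow> 'a) \<Rightarrow> _" "(*) :: 'a \<Rightarrow> 'a \<Rightarrow> 'a"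
    by unfold_locales (auto simp: algebra_simps)
  obtain g where "Vector_Spaces.linear fscale (*) g" "\<forall>x\<in>B. g x = h x"
    using linear_independent_extend[OF assms] by blast
  then show ?thesis by (intro exI[of _ g]) (auto simp: Vector_Spaces.linear_iff linear_form_def)
qed

lemma linear_form_coord:
  assumes "linear_form g" "finite I" "x \<in> coord_space I"
  shows "g x = (\<Sum>j\<in>I. x j * g (coord_unit j))"
proof -
  have "g x = g (\<Sum>j\<in>I. fscale (x j) (coord_unit j))"
    using coord_space_expansion[OF assms(2,3)] by simp
  also have "\<dots> = (\<Sum>j\<in>I. x j * g (coord_unit j))"
    using assms(1) by (simp add: linear_form_sum) (simp add: linear_form_def)
  finally show ?thesis .
qed

section \<open>Representatives of projective points and forms evaluated at them\<close>

definition rep :: "('i \<Rightarrow> 'a::field) set \<Rightarrow> 'i \<Rightarrow> 'a" where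
  "rep L = (SOME v. v \<noteq> 0 \<and> L = fvs.span {v})"

lemma
  assumes "L \<in> proj_of W"
  shows rep_nonzero: "rep L \<noteq> 0" and span_rep: "fvs.span {rep L} = L"
proof -
  have "\<exists>v. v \<noteq> 0 \<and> L = fvs.span {v}" using assms by (auto simp: proj_of_def)
  then have "rep L \<noteq> 0 \<and> L = fvs.span {rep L}" unfolding rep_def by (rule someI_ex)
  then show "rep L \<noteq> 0" "fvs.span {rep L} = L" by auto
qed

lemma rep_mem:
  assumes "L \<in> proj_of W" "fvs.subspace W"
  shows "rep L \<in> W"
proof -
  have "rep L \<in> L" using fvs.span_base[of "rep L" "{rep L}"] span_rep[OF assms(1)] by simp
  then show ?thesis using Union_proj_of[OF assms(2)] assms(1) by blast
qed

lemma rep_in_span: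
  assumes "p \<in> proj_of UNIV" "q \<in> proj_of UNIV" "rep p \<in> fvs.span {rep q}"
  shows "p = q"
proof -
  have "rep p \<notin> fvs.span {}" using rep_nonzero[OF assms(1)] by simp
  then have "rep q \<in> fvs.span {rep p}" using fvs.in_span_insert[of "rep p" "rep q" "{}"] assms(3) by simp
  then have "fvs.span {rep p} = fvs.span {rep q}"
    using assms(3) by (intro antisym fvs.span_minimal fvs.subspace_span) auto
  then show ?thesis using span_rep assms by metis
qed

lemma independent_rep_pair:
  assumes "p \<in> proj_of UNIV" "q \<in> proj_of UNIV" "p \<noteq> q"
  shows "fvs.independent {rep p, rep q}" "rep p \<noteq> rep q"
proof -
  have q: "rep p \<notin> fvs.span {rep q}" using rep_in_span[OF assms(1,2)] assms(3) by blast
  then show ne: "rep p \<noteq> rep q" using fvs.span_base[of "rep q" "{rep q}"] by auto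
  show "fvs.independent {rep p, rep q}"
    using q ne rep_nonzero[OF assms(2)] by (simp add: fvs.independent_insert)
qed

text \<open>A form has a well-defined zero set on projective points but no well-defined values;
  \<open>rep\<close> fixes values. The same \<open>rep\<close> enters \<open>segre_vec\<close>, so
  relations among Segre vectors carry over without rescaling.\<close>

definition point_forms :: "(('i \<Rightarrow> 'a::field) set \<Rightarrow> 'a) set" where
  "point_forms = {\<lambda>L. g (rep L) | g. linear_form g}"

lemma point_formsI: "linear_form g \<Longrightarrow> (\<lambda>L. g (rep L)) \<in> point_forms"
  by (auto simp: point_forms_def)

text \<open>Distinct points have independent representatives, on which the values 0 and 1 can be
  prescribed and extended linearly, over any field.\<close>

global_interpretation proj: separating "point_forms :: (('i \<Rightarrow> 'a::field) set \<Rightarrow> 'a) set" "proj_of UNIV"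
proof
  fix p q :: "('i \<Rightarrow> 'a) set"
  assume pq: "p \<in> proj_of UNIV" "q \<in> proj_of UNIV" "p \<noteq> q"
  obtain g where g: "linear_form g"
      "\<forall>x\<in>{rep p, rep q}. g x = (if x = rep p then 0 else 1)"
    using linear_form_extend[OF independent_rep_pair(1)[OF pq],
        of "\<lambda>x. if x = rep p then 0 else 1"] by (elim exE conjE)
  then have "g (rep p) = 0 \<and> g (rep q) \<noteq> 0" using independent_rep_pair(2)[OF pq] by auto
  then show "\<exists>f\<in>point_forms. f p = 0 \<and> f q \<noteq> 0"
    by (intro bexI[OF _ point_formsI[OF g(1)]]) simp
next
  fix q :: "('i \<Rightarrow> 'a) set"
  assume q: "q \<in> proj_of UNIV"
  have ind: "fvs.independent {rep q}" using rep_nonzero[OF q] by (simp add: fvs.independent_insert)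
  obtain g where g: "linear_form g" "\<forall>x\<in>{rep q}. g x = 1"
    using linear_form_extend[OF ind, of "\<lambda>_. 1"] by (elim exE conjE)
  then show "\<exists>f\<in>point_forms. f q \<noteq> 0"
    by (intro bexI[OF _ point_formsI[OF g(1)]]) simp
qed

section \<open>Segre vectors and the relations among them\<close>

lemma multiproj_factor:
  assumes "y \<in> multiproj k n" "i < k"
  shows "y i \<in> proj_of UNIV" "rep (y i) \<in> coord_space {..n i}"
proof -
  have y: "y i \<in> proj_of (coord_space {..n i})"
    using assms by (auto simp: multiproj_def proj_space_def PiE_def Pi_def)
  then show "y i \<in> proj_of UNIV" by (auto simp: proj_of_def)
  show "rep (y i) \<in> coord_space {..n i}" by (rule rep_mem[OF y subspace_coord_space])
qed

lemma multiproj_ext: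
  assumes "y \<in> multiproj k n" "z \<in> multiproj k n" "\<And>i. i \<in> {..<k} \<Longrightarrow> y i = z i"
  shows "y = z"
  using assms unfolding multiproj_def by (metis PiE_ext)

definition segre_vec :: "nat \<Rightarrow> (nat \<Rightarrow> nat) \<Rightarrow> (nat \<Rightarrow> (nat \<Rightarrow> 'a::field) set) \<Rightarrow> (nat \<Rightarrow> nat) \<Rightarrow> 'a" where
  "segre_vec k n y = tensor k n (\<lambda>i. rep (y i))"

lemma segre_eq_span:
  assumes "y \<in> multiproj k n"
  shows "segre k n y = fvs.span {segre_vec k n y}"
proof -
  have "y = (\<lambda>i\<in>{..<k}. fvs.span {rep (y i)})"
  proof
    fix i
    show "y i = (\<lambda>i\<in>{..<k}. fvs.span {rep (y i)}) i"
    proof (cases "i < k")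
      case True
      then show ?thesis using span_rep multiproj_factor[OF assms True] by fastforce
    next
      case False
      then show ?thesis using assms by (auto simp: multiproj_def PiE_def extensional_def)
    qed
  qed
  then show ?thesis unfolding segre_vec_def by (metis segre_point)
qed

lemma excess_eq:
  assumes "B \<subseteq> multiproj k n"
  shows "excess k n B = int (card B) - int (fvs.dim (segre_vec k n ` B))"
proof -
  have "\<Union>(segre k n ` B) = (\<Union>y\<in>B. fvs.span {segre_vec k n y})"
    using assms by (intro SUP_cong refl segre_eq_span) blast
  then show ?thesis by (simp add: excess_def pdim_lin_span dim_Union_lines)
qed

lemma pdim_factor:
  assumes "B \<subseteq> multiproj k n" "i < k"
  shows "pdim (lin_span ((\<lambda>y. y i) ` B)) = int (fvs.dim ((\<lambda>y. rep (y i)) ` B)) - 1"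
proof -
  have "\<Union>((\<lambda>y. y i) ` B) = (\<Union>y\<in>B. fvs.span {rep (y i)})"
  proof (intro SUP_cong refl)
    fix y assume "y \<in> B"
    then have "y \<in> multiproj k n" using assms(1) by blast
    then show "y i = fvs.span {rep (y i)}"
      using span_rep multiproj_factor(1)[OF _ assms(2)] by metis
  qed
  then show ?thesis by (simp add: pdim_lin_span dim_Union_lines[where f = "\<lambda>y. rep (y i)"])
qed

text \<open>A product of linear forms on the factors is a linear form on the tensor space;
  distributing the product over the coordinate sums makes this explicit. A linear relation among
  Segre vectors therefore vanishes under every such product.\<close>

lemma multi_rel_segre:
  assumes "B \<subseteq> multiproj k n" and rel: "(\<Sum>y\<in>B. fscale (c y) (segre_vec k n y)) = 0"
  shows "multi_rel point_forms {..<k} B c"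
  unfolding multi_rel_def
proof (intro allI impI)
  fix f :: "nat \<Rightarrow> (nat \<Rightarrow> 'a) set \<Rightarrow> 'a"
  assume "\<forall>i\<in>{..<k}. f i \<in> point_forms"
  then have "\<exists>g. linear_form g \<and> f i = (\<lambda>L. g (rep L))" if "i < k" for i
    using that by (auto simp: point_forms_def)
  then obtain g where g: "\<And>i. i < k \<Longrightarrow> linear_form (g i) \<and> f i = (\<lambda>L. g i (rep L))" by metis
  \<comment> \<open>The coefficients of the tensor product of the forms \<open>g i\<close>, in the
    coordinates of the target of the Segre embedding.\<close>
  define w where "w J = (\<Prod>i<k. g i (coord_unit (J i)))" for J
  have prod: "(\<Prod>i<k. f i (y i)) = (\<Sum>J\<in>multi_idx k n. segre_vec k n y J * w J)" if "y \<in> B" for y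
  proof -
    have "(\<Prod>i<k. f i (y i)) = (\<Prod>i<k. \<Sum>j\<le>n i. rep (y i) j * g i (coord_unit j))"
    proof (rule prod.cong[OF refl])
      fix i assume "i \<in> {..<k}"
      then have "i < k" by simp
      moreover from this have "rep (y i) \<in> coord_space {..n i}"
        using that assms(1) multiproj_factor(2) by blast
      ultimately show "f i (y i) = (\<Sum>j\<le>n i. rep (y i) j * g i (coord_unit j))"
        using linear_form_coord[of "g i" "{..n i}"] g by simp
    qed
    also have "\<dots> = (\<Sum>J\<in>multi_idx k n. \<Prod>i<k. rep (y i) (J i) * g i (coord_unit (J i)))"
      unfolding multi_idx_def by (rule prod_sum_PiE) auto
    also have "\<dots> = (\<Sum>J\<in>multi_idx k n. segre_vec k n y J * w J)"
      by (intro sum.cong) (auto simp: segre_vec_def tensor_def w_def prod.distrib)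
    finally show ?thesis .
  qed
  have "(\<Sum>y\<in>B. c y * (\<Prod>i<k. f i (y i))) =
      (\<Sum>y\<in>B. \<Sum>J\<in>multi_idx k n. c y * segre_vec k n y J * w J)"
    by (intro sum.cong) (auto simp: prod sum_distrib_left mult.assoc)
  also have "\<dots> = (\<Sum>J\<in>multi_idx k n. (\<Sum>y\<in>B. c y * segre_vec k n y J) * w J)"
    by (subst sum.swap) (simp add: sum_distrib_right)
  also have "\<dots> = 0"
  proof -
    have "(\<Sum>y\<in>B. c y * segre_vec k n y J) = 0" for J
      using fun_cong[OF rel, of J] by (simp add: sum_fun_apply fscale_def)
    then show ?thesis by simp
  qed
  finally show "(\<Sum>y\<in>B. c y * (\<Prod>i<k. f i (y i))) = 0" .
qed

text \<open>Equal vectors give a two-term relation with coefficients 1 and -1. Injectivity allows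
  scalars indexed by vectors to be reindexed by points.\<close>

lemma inj_on_segre_vec: "inj_on (segre_vec k n) (multiproj k n)"
proof (rule inj_onI, rule ccontr)
  fix y z :: "nat \<Rightarrow> (nat \<Rightarrow> 'a) set"
  assume yz: "y \<in> multiproj k n" "z \<in> multiproj k n" "segre_vec k n y = segre_vec k n z" "y \<noteq> z"
  define c :: "(nat \<Rightarrow> (nat \<Rightarrow> 'a) set) \<Rightarrow> 'a" where "c x = (if x = y then 1 else -1)" for x
  have "(\<Sum>x\<in>{y, z}. fscale (c x) (segre_vec k n x)) = 0"
    using yz(3,4) by (auto simp: c_def fscale_def fun_eq_iff)
  then have rel: "multi_rel point_forms {..<k} {y, z} c"
    using yz by (intro multi_rel_segre) auto
  have "y i = z i" if "i \<in> {..<k}" for i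
    by (rule proj.relation_two[OF rel]) (use yz multiproj_factor that in \<open>auto simp: c_def\<close>)
  then show False using multiproj_ext yz by blast
qed

lemma dependent_multi_rel:
  assumes "finite B" "B \<subseteq> multiproj k n" "fvs.dim (segre_vec k n ` B) < card B"
  shows "\<exists>c. multi_rel point_forms {..<k} B c \<and> (\<exists>y\<in>B. c y \<noteq> 0)"
proof -
  have inj: "inj_on (segre_vec k n) B" by (rule inj_on_subset[OF inj_on_segre_vec assms(2)])
  have "fvs.dependent (segre_vec k n ` B)"
    using fvs.dim_eq_card_independent assms(3) card_image[OF inj] by fastforce
  then obtain u where u: "\<exists>v\<in>segre_vec k n ` B. u v \<noteq> 0" "(\<Sum>v\<in>segre_vec k n ` B. fscale (u v) v) = 0"
    unfolding fvs.dependent_finite[OF finite_imageI[OF assms(1)]] by (elim exE conjE)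
  then have "(\<Sum>y\<in>B. fscale (u (segre_vec k n y)) (segre_vec k n y)) = 0"
    by (simp add: sum.reindex[OF inj])
  with multi_rel_segre[OF assms(2) this] u(1) show ?thesis by (intro exI conjI) auto
qed

lemma span_multi_rel:
  assumes "finite B" "B \<subseteq> multiproj k n" "a \<in> B" "segre_vec k n a \<in> fvs.span (segre_vec k n ` (B - {a}))"
  shows "\<exists>c. multi_rel point_forms {..<k} B c \<and> c a \<noteq> 0"
proof -
  have inj: "inj_on (segre_vec k n) (B - {a})"
    by (rule inj_on_subset[OF inj_on_segre_vec]) (use assms(2) in auto)
  obtain u where u: "segre_vec k n a = (\<Sum>v\<in>segre_vec k n ` (B - {a}). fscale (u v) v)"
    using assms(1,4) by (auto simp: fvs.span_finite)
  define c where "c y = (if y = a then - 1 else u (segre_vec k n y))" for y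
  have "(\<Sum>y\<in>B. fscale (c y) (segre_vec k n y)) =
      fscale (-1) (segre_vec k n a) + (\<Sum>y\<in>B - {a}. fscale (c y) (segre_vec k n y))"
    using assms(1,3) by (subst sum.remove[of _ a]) (auto simp: c_def)
  also have "(\<Sum>y\<in>B - {a}. fscale (c y) (segre_vec k n y)) = segre_vec k n a"
    unfolding u by (simp add: sum.reindex[OF inj] c_def)
  finally have "(\<Sum>y\<in>B. fscale (c y) (segre_vec k n y)) = 0"
    by (simp add: fscale_def fun_eq_iff)
  from multi_rel_segre[OF assms(2) this] have "multi_rel point_forms {..<k} B c" .
  moreover have "c a \<noteq> 0" by (simp add: c_def)
  ultimately show ?thesis by blast
qed

lemma multiproj_factors:
  assumes "B \<subseteq> multiproj k n"
  shows "\<forall>y\<in>B. \<forall>j\<in>{..<k}. y j \<in> proj_of UNIV"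
  using assms multiproj_factor(1) by blast

section \<open>Ranks of Segre images and of factor projections\<close>

lemma in_span_if_dim_le:
  assumes "finite W" "fvs.dim (insert x W) \<le> fvs.dim W"
  shows "x \<in> fvs.span W"
proof (rule ccontr)
  assume x: "x \<notin> fvs.span W"
  obtain B where B: "B \<subseteq> W" "fvs.independent B" "W \<subseteq> fvs.span B" "card B = fvs.dim W"
    by (rule fvs.basis_exists)
  have "x \<notin> fvs.span B" using x fvs.span_mono[OF B(1)] by blast
  moreover have "x \<notin> B" using x B(1) fvs.span_base[of x W] by blast
  moreover have "finite B" using B(1) assms(1) finite_subset by blast
  ultimately have "fvs.independent (insert x B)" "card (insert x B) = Suc (card B)"
    using B(2) by (auto simp: fvs.independent_insert)
  then have "fvs.dim (insert x B) = Suc (fvs.dim W)"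
    using fvs.dim_eq_card_independent B(4) by metis
  moreover have "fvs.dim (insert x B) \<le> fvs.dim (insert x W)"
    using assms(1) B(1) fvs.span_superset[of "insert x W"] by (intro dim_mono_finite) auto
  ultimately show False using assms(2) by simp
qed

lemma dim_image_subset:
  assumes "finite B" "C \<subseteq> B"
  shows "fvs.dim (f ` C) \<le> fvs.dim (f ` B)"
  using assms fvs.span_superset[of "f ` B"] by (intro dim_mono_finite) auto

lemma dim_le_card_coord:
  fixes V :: "('i \<Rightarrow> 'a::field) set"
  assumes "finite I" "V \<subseteq> coord_space I"
  shows "fvs.dim V \<le> card I"
proof -
  have "V \<subseteq> fvs.span (coord_unit ` I)"
  proof
    fix x assume "x \<in> V"
    then have "x \<in> coord_space I" using assms(2) by blast
    from coord_space_expansion[OF assms(1) this] show "x \<in> fvs.span (coord_unit ` I)"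
      by (metis (no_types, lifting) fvs.span_sum fvs.span_scale fvs.span_base imageI)
  qed
  then have "fvs.dim V \<le> card (coord_unit ` I :: ('i \<Rightarrow> 'a) set)"
    using assms(1) by (intro fvs.dim_le_card) auto
  also have "\<dots> \<le> card I" by (rule card_image_le[OF assms(1)])
  finally show ?thesis .
qed

text \<open>Vector-space dimension, one more than the projective dimension of the span; by
  \<open>excess_eq\<close>, the excess is cardinality minus rank.\<close>

abbreviation rank where "rank k n B \<equiv> fvs.dim (segre_vec k n ` B)"

abbreviation factor_rank where "factor_rank B i \<equiv> fvs.dim ((\<lambda>y. rep (y i)) ` B)"

lemma finite_multi_idx: "finite (multi_idx k n)"
  unfolding multi_idx_def by (intro finite_PiE) auto

lemma rank_le: "rank k n B \<le> (\<Prod>i<k. n i + 1)"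
proof -
  have "segre_vec k n ` B \<subseteq> coord_space (multi_idx k n)"
    by (auto simp: segre_vec_def tensor_def coord_space_def)
  then show ?thesis using dim_le_card_coord[OF finite_multi_idx] card_multi_idx by metis
qed

text \<open>Distinct points may share a projection, so a basis of the projected set is lifted to one
  point for each basis vector.\<close>

lemma factor_basis:
  obtains C where "C \<subseteq> B" "inj_on (\<lambda>y. rep (y i)) C"
    "fvs.independent ((\<lambda>y. rep (y i)) ` C)" "card C = factor_rank B i"
proof -
  obtain D where D: "D \<subseteq> (\<lambda>y. rep (y i)) ` B" "fvs.independent D" "card D = factor_rank B i"
    by (rule fvs.basis_exists)
  from D(1) obtain C where "C \<subseteq> B" "inj_on (\<lambda>y. rep (y i)) C" "D = (\<lambda>y. rep (y i)) ` C"
    unfolding subset_image_inj by (elim exE conjE)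
  with D show ?thesis by (intro that[of C]) (auto simp: card_image)
qed

lemma dual_form:
  assumes inj: "inj_on (\<lambda>y. rep (y i)) C" and ind: "fvs.independent ((\<lambda>y. rep (y i)) ` C)" and "x \<in> C"
  shows "\<exists>d\<in>point_forms. d (x i) \<noteq> 0 \<and> (\<forall>z\<in>C - {x}. d (z i) = 0)"
proof -
  obtain g where g: "linear_form g"
      "\<forall>v\<in>(\<lambda>y. rep (y i)) ` C. g v = (if v = rep (x i) then 1 else 0)"
    using linear_form_extend[OF ind, of "\<lambda>v. if v = rep (x i) then 1 else 0"] by (elim exE conjE)
  have "g (rep (z i)) = 0" if "z \<in> C - {x}" for z
    using g(2) that inj_onD[OF inj, of z x] assms(3) by auto
  then show ?thesis
    using g assms(3) by (intro bexI[OF _ point_formsI[OF g(1)]]) auto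
qed

text \<open>Independence in a single factor forces independence of the Segre vectors, because the
  forms dual to the projections isolate each coefficient.\<close>

lemma rank_factor_independent:
  assumes C: "C \<subseteq> multiproj k n" "finite C" and i: "i < k"
    and inj: "inj_on (\<lambda>y. rep (y i)) C" and ind: "fvs.independent ((\<lambda>y. rep (y i)) ` C)"
  shows "card C \<le> rank k n C"
proof (rule ccontr)
  assume "\<not> ?thesis"
  then obtain c x where c: "multi_rel point_forms {..<k} C c" and x: "x \<in> C" "c x \<noteq> 0"
    using dependent_multi_rel[OF C(2,1)] by auto
  obtain d where d: "d \<in> point_forms" "d (x i) \<noteq> 0" "\<forall>z\<in>C - {x}. d (z i) = 0"
    using dual_form[OF inj ind x(1)] by (elim bexE conjE)
  have "c x = 0"
    by (rule proj.no_relation_dual[OF c _ C(2) multiproj_factors[OF C(1)] _ x(1) d(1,2)])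
      (use i d(3) in auto)
  then show False using x by simp
qed

lemma factor_rank_le:
  assumes "B \<subseteq> multiproj k n" "finite B" "i < k"
  shows "factor_rank B i \<le> rank k n B"
proof -
  obtain C where C: "C \<subseteq> B" "inj_on (\<lambda>y. rep (y i)) C"
      "fvs.independent ((\<lambda>y. rep (y i)) ` C)" "card C = factor_rank B i"
    by (rule factor_basis)
  have "card C \<le> rank k n C"
    by (rule rank_factor_independent[OF _ _ assms(3) C(2,3)])
      (use C(1) assms finite_subset in auto)
  also have "\<dots> \<le> rank k n B" by (rule dim_image_subset[OF assms(2) C(1)])
  finally show ?thesis using C(4) by simp
qed

lemma factor_rank_ge_2:
  assumes "B \<subseteq> multiproj k n" "finite B" "i < k" "\<not> agree_at B i"
  shows "2 \<le> factor_rank B i"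
proof -
  obtain y z where yz: "y \<in> B" "z \<in> B" "y i \<noteq> z i" using assms(4) by (auto simp: agree_at_def)
  have pt: "y i \<in> proj_of UNIV" "z i \<in> proj_of UNIV"
    using yz assms(1,3) multiproj_factor(1) by blast+
  have "2 = fvs.dim {rep (y i), rep (z i)}"
    using fvs.dim_eq_card_independent[OF independent_rep_pair(1)[OF pt yz(3)]]
      independent_rep_pair(2)[OF pt yz(3)] by simp
  also have "\<dots> \<le> factor_rank B i"
    using dim_image_subset[of B "{y, z}" "\<lambda>y. rep (y i)"] assms(2) yz by simp
  finally show ?thesis .
qed

lemma factor_rank_agree:
  assumes "finite B" "agree_at B i"
  shows "factor_rank B i \<le> 1"
proof (cases "B = {}")
  case False
  then obtain y where y: "y \<in> B" by blast
  have "(\<lambda>y. rep (y i)) ` B \<subseteq> {rep (y i)}"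
    using agree_atD[OF assms(2) _ y] by auto
  then have "card ((\<lambda>y. rep (y i)) ` B) \<le> card {rep (y i)}" by (intro card_mono) auto
  then show ?thesis using fvs.dim_le_card'[of "(\<lambda>y. rep (y i)) ` B"] assms(1) by simp
qed (use fvs.dim_le_card'[of "(\<lambda>y. rep (y i)) ` B"] in simp)

lemma relation_support:
  assumes "B \<subseteq> multiproj k n" "finite B" "multi_rel point_forms {..<k} B c" "a \<in> B" "c a \<noteq> 0"
  shows "card {y \<in> B. c y \<noteq> 0} \<ge> 3"
  by (rule proj.support_ge_three[OF assms(3) _ assms(2) multiproj_factors[OF assms(1)] _ assms(4,5)])
    (use assms(1) multiproj_ext in blast)+

lemma rank_ge_2:
  assumes "B \<subseteq> multiproj k n" "finite B" "card B \<ge> 2"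
  shows "2 \<le> rank k n B"
proof -
  obtain C where C: "C \<subseteq> B" "card C = 2" "finite C"
    using obtain_subset_with_card_n[OF assms(3)] by blast
  have sub: "C \<subseteq> multiproj k n" using C(1) assms(1) by blast
  have "\<not> rank k n C < card C"
  proof
    assume "rank k n C < card C"
    then obtain c a where c: "multi_rel point_forms {..<k} C c" "a \<in> C" "c a \<noteq> 0"
      using dependent_multi_rel[OF C(3) sub] by auto
    have "card {y \<in> C. c y \<noteq> 0} \<le> card C" by (rule card_mono[OF C(3)]) auto
    then show False using relation_support[OF sub C(3) c] C(2) by simp
  qed
  then show ?thesis using C(2) dim_image_subset[OF assms(2) C(1), of "segre_vec k n"] by simp
qed

lemma dims_eq:
  assumes "B \<subseteq> multiproj k n"
  shows "min_multiproj_dims k B =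
    filter (\<lambda>m. m > 0) (map (\<lambda>i. int (factor_rank B i) - 1) [0..<k])"
  unfolding min_multiproj_dims_def using pdim_factor[OF assms]
  by (intro arg_cong[where f = "filter _"] map_cong) auto

lemma filter_map_unique:
  assumes "j < k" "f j > (0::int)" "\<And>i. i < k \<Longrightarrow> i \<noteq> j \<Longrightarrow> f i \<le> 0"
  shows "filter (\<lambda>m. m > 0) (map f [0..<k]) = [f j]"
proof -
  have "[0..<k] = [0..<j] @ j # [Suc j..<k]"
    using assms(1) upt_add_eq_append[of 0 j "k - j"] upt_conv_Cons[of j k] by simp
  moreover have "filter (\<lambda>m. m > 0) (map f [0..<j]) = []" "filter (\<lambda>m. m > 0) (map f [Suc j..<k]) = []"
    using assms(1,3) by (auto simp: filter_empty_conv not_less)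
  ultimately show ?thesis using assms(2) by simp
qed

section \<open>Classification\<close>

text \<open>Any three of the points carry a relation, which must involve all three, so they differ
  in one factor only. Fixing two points \<open>a\<close> and \<open>b\<close> that differ in factor
  \<open>j\<close> makes \<open>j\<close> that factor for every triple containing them. The rank of
  factor \<open>j\<close> is squeezed between 2 and \<open>rank k n B\<close>.\<close>

lemma collinear_dims:
  assumes B: "B \<subseteq> multiproj k n" "finite B" "card B \<ge> 3" and rank: "rank k n B \<le> 2"
  shows "min_multiproj_dims k B = [1]"
proof -
  have triple: "\<exists>j. \<forall>i\<in>{..<k} - {j}. agree_at {a, b, d} i"
    if abd: "a \<in> B" "b \<in> B" "d \<in> B" "card {a, b, d} = 3" for a b d
  proof -
    let ?T = "{a, b, d}"
    have T: "?T \<subseteq> multiproj k n" "finite ?T" using abd B by auto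
    have "rank k n ?T \<le> 2"
      using dim_image_subset[OF B(2), of ?T "segre_vec k n"] abd rank by auto
    then have "rank k n ?T < card ?T" using abd(4) by simp
    then obtain c x where c: "multi_rel point_forms {..<k} ?T c" "x \<in> ?T" "c x \<noteq> 0"
      using dependent_multi_rel[OF T(2,1)] by blast
    have "{y \<in> ?T. c y \<noteq> 0} = ?T"
      by (rule card_seteq) (use relation_support[OF T c] abd(4) in auto)
    then show ?thesis
      using proj.relation_three[OF c(1) _ T(2) multiproj_factors[OF T(1)]] by blast
  qed
  have "2 \<le> card B" using B(3) by simp
  then obtain C where C: "C \<subseteq> B" "card C = 2" by (rule obtain_subset_with_card_n)
  then obtain a b where ab: "a \<in> B" "b \<in> B" "a \<noteq> b" unfolding card_2_iff by auto
  then obtain j where j: "j < k" "a j \<noteq> b j" using multiproj_ext B(1) by blast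
  have agree3: "agree_at {a, b, y} i" if y: "y \<in> B" "y \<notin> {a, b}" and i: "i < k" "i \<noteq> j" for y i
  proof -
    have "card {a, b, y} = 3" using y ab by auto
    then obtain j' where j': "\<forall>i\<in>{..<k} - {j'}. agree_at {a, b, y} i"
      using triple[OF ab(1,2) y(1)] by blast
    have "j' = j"
    proof (rule ccontr)
      assume "j' \<noteq> j"
      then have "agree_at {a, b, y} j" using j' j(1) by blast
      then show False using j(2) by (auto simp: agree_at_def)
    qed
    then show ?thesis using j' i by blast
  qed
  have "\<not> B \<subseteq> {a, b}" using B(3) card_mono[of "{a, b}" B] ab(3) by auto
  then obtain d where d: "d \<in> B" "d \<notin> {a, b}" by blast
  have agree: "y i = a i" if y: "y \<in> B" and i: "i < k" "i \<noteq> j" for y i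
  proof (cases "y \<in> {a, b}")
    case True
    then show ?thesis using agree_atD[OF agree3[OF d i], of y a] by auto
  next
    case False
    then show ?thesis using agree_atD[OF agree3[OF y False i], of y a] by auto
  qed
  have "int (factor_rank B i) - 1 \<le> 0" if i: "i < k" "i \<noteq> j" for i
  proof -
    have "agree_at B i" using agree i by (intro agree_atI[where p = "a i"]) blast
    then show ?thesis using factor_rank_agree[OF B(2)] by fastforce
  qed
  moreover have "factor_rank B j = 2"
  proof -
    have "\<not> agree_at B j" using ab j by (auto simp: agree_at_def)
    then show ?thesis
      using factor_rank_ge_2[OF B(1,2) j(1)] factor_rank_le[OF B(1,2) j(1)] rank by linarith
  qed
  ultimately show ?thesis
    unfolding dims_eq[OF B(1)]
    using filter_map_unique[of j k "\<lambda>i. int (factor_rank B i) - 1"] j(1) by simp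
qed

lemma nondegenerate_factor_rank:
  assumes "S \<subseteq> multiproj k n" "nondegenerate k n S" "S \<noteq> {}" "i < k"
  shows "factor_rank S i = n i + 1"
proof -
  have "(\<Pi>\<^sub>E i\<in>{..<k}. lin_span ((\<lambda>y. y i) ` S)) = (\<Pi>\<^sub>E i\<in>{..<k}. proj_space (n i))"
    using assms(2) by (simp add: nondegenerate_def min_multiproj_def multiproj_def)
  \<comment> \<open>Equal products have equal factors once they are nonempty; a point of
    \<open>S\<close> shows this.\<close>
  moreover have "(\<Pi>\<^sub>E i\<in>{..<k}. proj_space (n i) :: (nat \<Rightarrow> 'a) set set) \<noteq> {}"
    using assms(1,3) by (auto simp: multiproj_def)
  ultimately have "lin_span ((\<lambda>y. y i) ` S) = proj_space (n i)"
    using assms(4) by (subst (asm) PiE_eq_iff) (auto simp: PiE_eq_empty_iff)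
  then have "pdim (lin_span ((\<lambda>y. y i) ` S)) = int (n i)" by (simp add: pdim_proj_space)
  then show ?thesis using pdim_factor[OF assms(1,4)] by simp
qed

lemma nondegenerate_dims:
  assumes "S \<subseteq> multiproj k n" "nondegenerate k n S" "S \<noteq> {}" "\<forall>i<k. n i > 0"
  shows "min_multiproj_dims k S = map (\<lambda>i. int (n i)) [0..<k]"
proof -
  have "map (\<lambda>i. int (factor_rank S i) - 1) [0..<k] = map (\<lambda>i. int (n i)) [0..<k]"
    using nondegenerate_factor_rank[OF assms(1-3)] by (intro map_cong) auto
  then show ?thesis using assms(4) by (simp add: dims_eq[OF assms(1)] filter_map filter_id_conv)
qed

text \<open>In matroid language \<open>a\<close> is not a coloop: its Segre vector lies in the span
  of the others, which gives a relation involving \<open>a\<close>.\<close>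

lemma relation_through:
  assumes S: "S \<subseteq> multiproj k n" "finite S" and a: "a \<in> S"
    and no_coloop: "rank k n S \<le> rank k n (S - {a})"
  shows "\<exists>c. multi_rel point_forms {..<k} S c \<and> c a \<noteq> 0"
proof (rule span_multi_rel[OF S(2,1) a], rule in_span_if_dim_le)
  have "insert (segre_vec k n a) (segre_vec k n ` (S - {a})) = segre_vec k n ` S" using a by auto
  then show "fvs.dim (insert (segre_vec k n a) (segre_vec k n ` (S - {a}))) \<le> rank k n (S - {a})"
    using no_coloop by simp
qed (use S in auto)

text \<open>The projection spans a two-dimensional space, and a form on it that is 0 at
  \<open>x i\<close> but not at some other point \<open>z i\<close> has exactly the line
  \<open>x i\<close> as kernel.\<close>

lemma kill_factor:
  assumes S: "S \<subseteq> multiproj k n" "finite S" and i: "i < k" "\<not> agree_at S i"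
    and rank2: "factor_rank S i \<le> 2" and x: "x \<in> S"
  shows "\<exists>g\<in>point_forms. \<forall>y\<in>S. g (y i) = 0 \<longleftrightarrow> y i = x i"
proof -
  obtain z where z: "z \<in> S" "x i \<noteq> z i"
    using i(2) x unfolding agree_at_def by metis
  have pt: "y i \<in> proj_of UNIV" if "y \<in> S" for y using that S(1) i(1) multiproj_factor(1) by blast
  let ?u = "rep (x i)" and ?v = "rep (z i)"
  note ind = independent_rep_pair[OF pt[OF x] pt[OF z(1)] z(2)]
  obtain g where g: "linear_form g" "\<forall>w\<in>{?u, ?v}. g w = (if w = ?u then 0 else 1)"
    using linear_form_extend[OF ind(1), of "\<lambda>w. if w = ?u then 0 else 1"] by (elim exE conjE)
  have dim: "fvs.dim {?u, ?v} = 2" using fvs.dim_eq_card_independent[OF ind(1)] ind(2) by simp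
  have "g (rep (y i)) = 0 \<longleftrightarrow> y i = x i" if y: "y \<in> S" for y
  proof
    assume g0: "g (rep (y i)) = 0"
    have "fvs.dim (insert (rep (y i)) {?u, ?v}) \<le> factor_rank S i"
      using dim_image_subset[of S "{y, x, z}" "\<lambda>y. rep (y i)"] S(2) x z y by simp
    then have "rep (y i) \<in> fvs.span {?u, ?v}"
      using rank2 dim by (intro in_span_if_dim_le) auto
    then have "rep (y i) \<in> fvs.span (insert ?v {?u})" by (simp add: insert_commute)
    then have "\<exists>b. rep (y i) - fscale b ?v \<in> fvs.span {?u}"
      by (rule fvs.span_breakdown_eq[THEN iffD1])
    then obtain b where b: "rep (y i) - fscale b ?v \<in> fvs.span {?u}" by blast
    then obtain a where "rep (y i) - fscale b ?v = fscale a ?u"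
      by (auto simp: fvs.span_singleton)
    then have eq: "rep (y i) = fscale a ?u + fscale b ?v" by (simp add: algebra_simps)
    have "g (rep (y i)) = a * g ?u + b * g ?v"
      unfolding eq using g(1) unfolding linear_form_def by metis
    then have "b = 0" using g0 g(2) ind(2) by simp
    then have "rep (y i) \<in> fvs.span {?u}" using b by (simp add: fscale_def zero_fun_def[symmetric])
    then show "y i = x i" using rep_in_span pt x y by blast
  next
    assume "y i = x i"
    then show "g (rep (y i)) = 0" using g(2) by simp
  qed
  then show ?thesis by (intro bexI[OF _ point_formsI[OF g(1)]]) auto
qed

text \<open>Three points \<open>C\<close> independent in factor \<open>i\<close> serve as a basis.
  Each of the two remaining points agrees outside \<open>i\<close> with at least two points of
  \<open>C\<close>. Two such subsets of a three-element set meet, so at least four points agree in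
  factor \<open>m\<close>, and \<open>agree_extend\<close> adds the fifth.\<close>

lemma large_factor:
  assumes S: "S \<subseteq> multiproj k n" "card S = 5" and rank: "rank k n S = 3"
    and no_coloop: "\<And>a. a \<in> S \<Longrightarrow> rank k n (S - {a}) = 3"
    and i: "i < k" "factor_rank S i \<ge> 3" and m: "m < k" "m \<noteq> i"
  shows "agree_at S m"
proof -
  have finS: "finite S" using S(2) card.infinite by force
  obtain C where C: "C \<subseteq> S" "inj_on (\<lambda>y. rep (y i)) C"
      "fvs.independent ((\<lambda>y. rep (y i)) ` C)" "card C = factor_rank S i"
    by (rule factor_basis)
  have card_C: "card C = 3" using C(4) i factor_rank_le[OF S(1) finS i(1)] rank by simp
  have finC: "finite C" using C(1) finS finite_subset by blast
  have agree_C: "\<exists>T\<subseteq>C. card T \<ge> 2 \<and> agree_at (insert y T) m" if y: "y \<in> S - C" for y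
  proof -
    have yC: "insert y C \<subseteq> multiproj k n" "finite (insert y C)"
      using y C(1) S(1) finC by auto
    have "rank k n (insert y C) \<le> 3"
      using dim_image_subset[OF finS, of "insert y C" "segre_vec k n"] y C(1) rank by simp
    then have "rank k n (insert y C) < card (insert y C)" using y finC card_C by simp
    then obtain c a where c: "multi_rel point_forms {..<k} (insert y C) c" "a \<in> insert y C" "c a \<noteq> 0"
      using dependent_multi_rel[OF yC(2,1)] by blast
    \<comment> \<open>The relation has at least three terms, at most one of which is that of
      \<open>y\<close>; hence at least two points of \<open>C\<close> occur.\<close>
    define T where "T = {x \<in> C. c x \<noteq> 0}"
    have "{z \<in> insert y C. c z \<noteq> 0} \<subseteq> insert y T" by (auto simp: T_def)
    then have "card {z \<in> insert y C. c z \<noteq> 0} \<le> card (insert y T)"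
      using finC by (intro card_mono) (auto simp: T_def)
    moreover have "card (insert y T) \<le> Suc (card T)" using finC by (simp add: card_insert_if T_def)
    ultimately have "card T \<ge> 2" using relation_support[OF yC c] by simp
    moreover have "x m = y m" if "x \<in> T" for x
    proof -
      have x: "x \<in> C" "c x \<noteq> 0" using that by (auto simp: T_def)
      obtain d where d: "d \<in> point_forms" "d (x i) \<noteq> 0" "\<forall>z\<in>C - {x}. d (z i) = 0"
        using dual_form[OF C(2,3) x(1)] by (elim bexE conjE)
      show ?thesis
        by (rule proj.agree_off_basis[OF c(1) _ finC multiproj_factors[OF yC(1)] _ x d(1,2)])
          (use d(3) i m in auto)
    qed
    then have "agree_at (insert y T) m" by (intro agree_atI[where p = "y m"]) auto
    ultimately show ?thesis by (intro exI[of _ T]) (auto simp: T_def)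
  qed
  have "card (S - C) = 2" using card_Diff_subset[OF finC C(1)] S(2) card_C by simp
  then obtain y z where yz: "S - C = {y, z}" "y \<noteq> z" by (auto simp: card_2_iff)
  then have mem: "y \<in> S - C" "z \<in> S - C" by auto
  obtain T where T: "T \<subseteq> C" "card T \<ge> 2" "agree_at (insert y T) m"
    using agree_C[OF mem(1)] by blast
  obtain U where U: "U \<subseteq> C" "card U \<ge> 2" "agree_at (insert z U) m"
    using agree_C[OF mem(2)] by blast
  have fin: "finite T" "finite U" using T(1) U(1) finC finite_subset by blast+
  have "card (T \<union> U) \<le> 3" unfolding card_C[symmetric] by (rule card_mono[OF finC]) (use T U in auto)
  then have "T \<inter> U \<noteq> {}" using card_Un_Int[OF fin] T(2) U(2) by auto
  then have agree: "agree_at (insert y T \<union> insert z U) m"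
    using T(3) U(3) by (intro agree_at_Un) auto
  \<comment> \<open>\<open>y\<close> and \<open>z\<close> lie outside \<open>C\<close>, so they add
    two points to the two or more in \<open>T\<close>.\<close>
  have "card (insert y (insert z T)) = card T + 2"
    using fin T(1) yz mem by (subst card_insert_disjoint; auto)+
  moreover have "card (insert y (insert z T)) \<le> card (insert y T \<union> insert z U)"
    using fin by (intro card_mono) auto
  ultimately have "4 \<le> card (insert y T \<union> insert z U)" using T(2) by simp
  then show ?thesis
    by (intro proj.agree_extend[OF finite_lessThan S(2) multiproj_factors[OF S(1)] _ _ _ _ agree]
        relation_through[OF S(1) finS])
      (use rank no_coloop m mem T U C(1) in auto)
qed

text \<open>By \<open>spread\<close> no factor is constant on \<open>S\<close>, so agreement outside
  one or two factors bounds \<open>k\<close>. Without a factor of rank 3 or more, all projections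
  are lines and \<open>kill_factor\<close> supplies the forms for
  \<open>five_points\<close>.\<close>

lemma planar_factors:
  assumes S: "S \<subseteq> multiproj k n" "card S = 5" and rank: "rank k n S = 3"
    and no_coloop: "\<And>a. a \<in> S \<Longrightarrow> rank k n (S - {a}) = 3"
    and k: "1 \<le> k" and spread: "\<And>i. i < k \<Longrightarrow> factor_rank S i \<ge> 2"
  shows "k = 1 \<or> k = 2 \<and> factor_rank S 0 = 2 \<and> factor_rank S 1 = 2"
proof -
  have finS: "finite S" using S(2) card.infinite by force
  have no_agree: "\<not> agree_at S i" if "i < k" for i
    using factor_rank_agree[OF finS, of i] spread[OF that] by auto
  show ?thesis
  proof (cases "\<exists>i<k. factor_rank S i \<ge> 3")
    case True
    then obtain i where i: "i < k" "factor_rank S i \<ge> 3" by blast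
    have "m = i" if "m < k" for m
      using large_factor[OF S rank no_coloop i that] no_agree[OF that] by blast
    then have "0 = i" "k - 1 = i" using k by force+
    then show ?thesis using k by simp
  next
    case False
    then have two: "factor_rank S i = 2" if "i < k" for i using spread[OF that] that by force
    have "\<exists>i j. \<forall>m\<in>{..<k} - {i, j}. agree_at S m"
    proof (rule proj.five_points[OF finite_lessThan S(2) multiproj_factors[OF S(1)]])
      show "y = z" if "y \<in> S" "z \<in> S" "\<And>i. i \<in> {..<k} \<Longrightarrow> y i = z i" for y z
        using multiproj_ext that S(1) by blast
      show "\<forall>x\<in>S. \<forall>i\<in>{..<k}. \<exists>g\<in>point_forms. \<forall>y\<in>S. g (y i) = 0 \<longleftrightarrow> y i = x i"
        using kill_factor[OF S(1) finS] no_agree two by auto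
      show "\<exists>c. multi_rel point_forms {..<k} S c \<and> c a \<noteq> 0" if "a \<in> S" for a
        using relation_through[OF S(1) finS that] rank no_coloop[OF that] by simp
      show "\<exists>c. multi_rel point_forms {..<k} (S - {a}) c \<and> (\<exists>y\<in>S - {a}. c y \<noteq> 0)" if "a \<in> S" for a
        by (rule dependent_multi_rel) (use finS S that no_coloop[OF that] in auto)
    qed
    then obtain i j where "\<forall>m\<in>{..<k} - {i, j}. agree_at S m" by blast
    then have "{..<k} \<subseteq> {i, j}" using no_agree by blast
    then have "card {..<k} \<le> card {i, j}" by (intro card_mono) auto
    also have "\<dots> \<le> 2" by (simp add: card_insert_if)
    finally have "k \<le> 2" by simp
    then consider "k = 1" | "k = 2" using k by linarith
    then show ?thesis using two by cases auto
  qed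
qed

text \<open>The excess is 5 minus the rank, and two points already have rank 2, so the rank is 2 or
  3. The kernel \<open>A\<close> has the same excess and rank at least 2, hence five points in the
  first case and four or five in the second.\<close>

lemma five_point_classification:
  assumes five: "five_point_setup k n S A"
  shows "(excess k n S = 3 \<and> A = S \<and> min_multiproj_dims k A = [1]) \<or>
      (excess k n S = 2 \<and> A = S \<and> min_multiproj_dims k A = [2]) \<or>
      (excess k n S = 2 \<and> A = S \<and> min_multiproj_dims k A = [1, 1]) \<or>
      (excess k n S = 2 \<and> card A = 4 \<and> min_multiproj_dims k A = [1])"
proof -
  have k: "1 \<le> k" and n: "\<forall>i<k. n i > 0" and S: "S \<subseteq> multiproj k n" "card S = 5"
    and nondeg: "nondegenerate k n S" and e: "excess k n S \<ge> 2"
    and A: "A \<subseteq> S" "excess k n A = excess k n S"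
    and minimal: "\<And>B. B \<subset> A \<Longrightarrow> excess k n B \<noteq> excess k n S"
    using five by (auto simp: five_point_setup_def is_kernel_def)
  have finS: "finite S" "S \<noteq> {}" using S(2) card.infinite by force+
  have finA: "finite A" and A': "A \<subseteq> multiproj k n" using A(1) S(1) finS finite_subset by auto
  have card_A: "card A \<le> 5" using card_mono[OF finS(1) A(1)] S(2) by simp
  have eS: "excess k n S = 5 - int (rank k n S)" using excess_eq[OF S(1)] S(2) by simp
  have eA: "excess k n A = int (card A) - int (rank k n A)" using excess_eq[OF A'] by simp
  have rank_S: "2 \<le> rank k n S" using rank_ge_2[OF S(1) finS(1)] S(2) by simp
  have rank_A: "2 \<le> rank k n A" if "2 \<le> card A" using rank_ge_2[OF A' finA that] .
  have A_eq: "A = S" if "card A = 5" using card_subset_eq[OF finS(1) A(1)] that S(2) by simp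
  consider "rank k n S = 2" | "rank k n S = 3" using eS e rank_S by linarith
  then show ?thesis
  proof cases
    case 1
    then have "card A = 5" using eS eA A(2) card_A rank_A by linarith
    then have "A = S" by (rule A_eq)
    then show ?thesis using 1 eS collinear_dims[OF S(1) finS(1)] S(2) by simp
  next
    case rank3: 2
    then have e2: "excess k n S = 2" using eS by simp
    have "card A \<ge> 4" using e2 eA A(2) rank_A by linarith
    then consider "card A = 4" | "card A = 5" using card_A by linarith
    then show ?thesis
    proof cases
      case 1
      then have "rank k n A = 2" using eA A(2) e2 by simp
      then show ?thesis using 1 e2 collinear_dims[OF A' finA] by simp
    next
      case 2
      then have AS: "A = S" by (rule A_eq)
      \<comment> \<open>Removing \<open>a\<close> from the minimal set \<open>S\<close> must change
        the excess. Rank 2 on the remaining four points would keep it at 2, so their rank is still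
        3.\<close>
      have no_coloop: "rank k n (S - {a}) = 3" if a: "a \<in> S" for a
      proof -
        have Sa: "S - {a} \<subseteq> multiproj k n" "finite (S - {a})" "card (S - {a}) = 4"
          using S finS a by auto
        have "excess k n (S - {a}) \<noteq> 2" using minimal[of "S - {a}"] e2 AS a by auto
        then have "rank k n (S - {a}) \<noteq> 2" using excess_eq[OF Sa(1)] Sa(3) by simp
        moreover have "2 \<le> rank k n (S - {a})" using rank_ge_2[OF Sa(1,2)] Sa(3) by simp
        moreover have "rank k n (S - {a}) \<le> 3"
          using dim_image_subset[OF finS(1), of "S - {a}" "segre_vec k n"] rank3 by auto
        ultimately show ?thesis by simp
      qed
      note fr = nondegenerate_factor_rank[OF S(1) nondeg finS(2)]
      note dims = nondegenerate_dims[OF S(1) nondeg finS(2) n]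
      have "k = 1 \<or> k = 2 \<and> factor_rank S 0 = 2 \<and> factor_rank S 1 = 2"
        by (rule planar_factors[OF S rank3 no_coloop k]) (use fr n in auto)
      then show ?thesis
      proof (elim disjE conjE)
        assume k1: "k = 1"
        \<comment> \<open>The rank 3 is at least the factor rank \<open>n 0 + 1\<close> and at most
          the number \<open>n 0 + 1\<close> of coordinates.\<close>
        have "n 0 = 2"
          using factor_rank_le[OF S(1) finS(1), of 0] fr[of 0] rank_le[of k n S] k1 rank3
          by simp
        then show ?thesis using dims e2 AS k1 by simp
      next
        assume "k = 2" "factor_rank S 0 = 2" "factor_rank S 1 = 2"
        then show ?thesis using dims e2 AS fr[of 0] fr[of 1] by (simp add: upt_rec)
      qed
    qed
  qed
qed

section \<open>Examples\<close>

text \<open>The kernels of the examples are not computed: one exists, and the classification with a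
  few invariants of \<open>S\<close> leaves a single possibility.\<close>

lemma kernel_exists:
  assumes "finite S"
  shows "\<exists>A. is_kernel k n S A"
proof -
  let ?K = "{A. A \<subseteq> S \<and> excess k n A = excess k n S}"
  have "finite ?K" using assms by simp
  moreover have "?K \<noteq> {}" by blast
  ultimately have "\<exists>A\<in>?K. \<forall>B\<in>?K. B \<le> A \<longrightarrow> A = B" by (rule finite_has_minimal)
  then obtain A where A: "A \<in> ?K" "\<forall>B\<in>?K. B \<subseteq> A \<longrightarrow> A = B" by (elim bexE)
  have "excess k n B \<noteq> excess k n S" if "B \<subset> A" for B using A that by auto
  then show ?thesis using A(1) unfolding is_kernel_def by auto
qed

lemma nondegenerateI:
  assumes S: "S \<subseteq> multiproj k n"
    and units: "\<And>i j. i < k \<Longrightarrow> j \<le> n i \<Longrightarrow> coord_unit j \<in> fvs.span (\<Union>y\<in>S. y i)"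
  shows "nondegenerate k n S"
  unfolding nondegenerate_def min_multiproj_def multiproj_def
proof (rule PiE_cong)
  fix i assume "i \<in> {..<k}"
  then have i: "i < k" by simp
  have "fvs.span (\<Union>y\<in>S. y i) = coord_space {..n i}"
  proof (rule antisym)
    have "y i \<subseteq> coord_space {..n i}" if "y \<in> S" for y
    proof -
      have y: "y \<in> multiproj k n" using that S by blast
      show ?thesis
        using fvs.span_minimal[OF _ subspace_coord_space, of "{rep (y i)}" "{..n i}"]
          span_rep[OF multiproj_factor(1)[OF y i]] multiproj_factor(2)[OF y i] by simp
    qed
    then show "fvs.span (\<Union>y\<in>S. y i) \<subseteq> coord_space {..n i}"
      by (intro fvs.span_minimal subspace_coord_space) blast
    show "coord_space {..n i} \<subseteq> fvs.span (\<Union>y\<in>S. y i)"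
    proof
      fix x :: "nat \<Rightarrow> 'a" assume "x \<in> coord_space {..n i}"
      then have "x = (\<Sum>j\<le>n i. fscale (x j) (coord_unit j))"
        by (intro coord_space_expansion) auto
      also have "\<dots> \<in> fvs.span (\<Union>y\<in>S. y i)"
        using units[OF i] by (intro fvs.span_sum fvs.span_scale) auto
      finally show "x \<in> fvs.span (\<Union>y\<in>S. y i)" .
    qed
  qed
  then show "lin_span ((\<lambda>y. y i) ` S) = proj_space (n i)"
    by (simp add: lin_span_def proj_space_def)
qed

section \<open>Points with explicit coordinates\<close>

definition mpoint :: "nat \<Rightarrow> (nat \<Rightarrow> nat \<Rightarrow> 'a::field) \<Rightarrow> nat \<Rightarrow> (nat \<Rightarrow> 'a) set" where
  "mpoint k v = (\<lambda>i\<in>{..<k}. fvs.span {v i})"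

lemma mpoint_mem:
  assumes "\<And>i. i < k \<Longrightarrow> v i \<in> coord_space {..n i} \<and> v i \<noteq> 0"
  shows "mpoint k v \<in> multiproj k n"
  using assms by (auto simp: mpoint_def multiproj_def proj_space_def proj_of_def)

text \<open>Proportional vectors have vanishing 2 by 2 minors; this turns distinctness of concrete
  points into arithmetic.\<close>

lemma span_eq_cross:
  assumes "fvs.span {u} = fvs.span {w}"
  shows "u i * w j = u j * w i"
proof -
  have "u \<in> fvs.span {w}" using assms fvs.span_base[of u "{u}"] by simp
  then obtain c where "u = fscale c w" by (auto simp: fvs.span_singleton)
  then show ?thesis by (simp add: fscale_def)
qed

definition vec3 :: "'a::field \<Rightarrow> 'a \<Rightarrow> 'a \<Rightarrow> nat \<Rightarrow> 'a" where
  "vec3 a b c = (\<lambda>j. if j = 0 then a else if j = 1 then b else if j = 2 then c else 0)"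

lemma vec3_eq_iff: "vec3 a b c = vec3 a' b' c' \<longleftrightarrow> a = a' \<and> b = b' \<and> c = c'"
proof
  assume eq: "vec3 a b c = vec3 a' b' c'"
  show "a = a' \<and> b = b' \<and> c = c'"
    using fun_cong[OF eq, of 0] fun_cong[OF eq, of 1] fun_cong[OF eq, of 2] by (simp add: vec3_def)
qed simp

lemma vec3_eq_0_iff: "vec3 a b c = 0 \<longleftrightarrow> a = 0 \<and> b = 0 \<and> c = 0"
proof -
  have zero: "(0 :: nat \<Rightarrow> 'a) = vec3 0 0 0" by (auto simp: vec3_def)
  show ?thesis by (subst zero) (rule vec3_eq_iff)
qed

lemma vec3_diff: "vec3 a b c - vec3 a' b' c' = vec3 (a - a') (b - b') (c - c')"
  by (auto simp: vec3_def fun_eq_iff)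

lemma fscale_vec3: "fscale t (vec3 a b c) = vec3 (t * a) (t * b) (t * c)"
  by (auto simp: vec3_def fscale_def fun_eq_iff)

lemma coord_unit_vec3:
  "coord_unit 0 = vec3 1 0 0" "coord_unit (Suc 0) = vec3 0 1 0" "coord_unit 2 = vec3 0 0 1"
  by (auto simp: vec3_def coord_unit_def fun_eq_iff)

lemma vec3_mem_plane: "vec3 a b c \<in> coord_space {..2}"
  by (auto simp: vec3_def coord_space_def)

lemma vec3_mem_line: "vec3 a b 0 \<in> coord_space {..Suc 0}"
  by (auto simp: vec3_def coord_space_def)

lemma span_vec3_eqD:
  assumes "fvs.span {vec3 a b c} = fvs.span {vec3 a' b' c'}"
  shows "a * b' = b * a' \<and> a * c' = c * a' \<and> b * c' = c * b'"
  using span_eq_cross[OF assms, of 0 1] span_eq_cross[OF assms, of 0 2] span_eq_cross[OF assms, of 1 2]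
  by (simp add: vec3_def)

definition point1 :: "(nat \<Rightarrow> 'a::field) \<Rightarrow> nat \<Rightarrow> (nat \<Rightarrow> 'a) set" where
  "point1 v = mpoint 1 (\<lambda>_. v)"

lemma point1_apply: "point1 v 0 = fvs.span {v}"
  by (simp add: point1_def mpoint_def)

lemma point1_eq_iff: "point1 u = point1 w \<longleftrightarrow> fvs.span {u} = fvs.span {w}"
proof
  assume "point1 u = point1 w"
  from fun_cong[OF this, of 0] show "fvs.span {u} = fvs.span {w}" by (simp add: point1_apply)
qed (simp add: point1_def mpoint_def)

lemma nondegenerate_point1:
  assumes V: "V \<subseteq> coord_space {..N} - {0}" and units: "\<And>j. j \<le> N \<Longrightarrow> coord_unit j \<in> fvs.span V"
  shows "point1 ` V \<subseteq> multiproj 1 (\<lambda>_. N)" "nondegenerate 1 (\<lambda>_. N) (point1 ` V)"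
proof -
  show sub: "point1 ` V \<subseteq> multiproj 1 (\<lambda>_. N)" using V by (auto simp: point1_def intro!: mpoint_mem)
  have "V \<subseteq> (\<Union>y\<in>point1 ` V. y 0)" by (auto simp: point1_apply intro: fvs.span_base)
  then have "fvs.span V \<subseteq> fvs.span (\<Union>y\<in>point1 ` V. y 0)" by (rule fvs.span_mono)
  then show "nondegenerate 1 (\<lambda>_. N) (point1 ` V)" using units by (intro nondegenerateI[OF sub]) auto
qed

text \<open>With one factor, the rank lies between the factor rank and the number of coordinates,
  and both are \<open>N + 1\<close>.\<close>

lemma excess_nondegenerate_1:
  assumes S: "S \<subseteq> multiproj 1 (\<lambda>_. N)" "finite S" "S \<noteq> {}" and nondeg: "nondegenerate 1 (\<lambda>_. N) S"
  shows "excess 1 (\<lambda>_. N) S = int (card S) - int (N + 1)"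
proof -
  have "rank 1 (\<lambda>_. N) S = N + 1"
    using nondegenerate_factor_rank[OF S(1) nondeg S(3), of 0] factor_rank_le[OF S(1,2), of 0]
      rank_le[of 1 "\<lambda>_. N" S] by simp
  then show ?thesis using excess_eq[OF S(1)] by simp
qed

lemma five_point_setup_exists:
  assumes "1 \<le> k" "\<forall>i<k. n i > 0" "S \<subseteq> multiproj k n" "nondegenerate k n S" "card S = 5" "2 \<le> excess k n S"
  shows "\<exists>A. five_point_setup k n S A"
proof -
  have "finite S" using assms(5) card.infinite by force
  then obtain A where "is_kernel k n S A" using kernel_exists by blast
  then show ?thesis using assms by (auto simp: five_point_setup_def)
qed

lemma obtain_scalars:
  assumes "finite (UNIV :: 'a set) \<longrightarrow> card (UNIV :: 'a set) \<ge> m"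
  obtains T :: "'a set" where "finite T" "card T = m"
  using assms infinite_arbitrarily_large[of "UNIV :: 'a set" m] obtain_subset_with_card_n[of m "UNIV :: 'a set"]
  by (metis)

text \<open>The point at infinity and the affine points with parameters in \<open>T\<close>: one
  point more than \<open>T\<close> has elements, so five and four points take 4 and 3
  scalars.\<close>

definition line_vecs :: "'a::field set \<Rightarrow> (nat \<Rightarrow> 'a) set" where
  "line_vecs T = insert (vec3 0 1 0) ((\<lambda>t. vec3 1 t 0) ` T)"

lemma line_vecs_mem: "line_vecs T \<subseteq> coord_space {..Suc 0} - {0}"
  using vec3_mem_line by (auto simp: line_vecs_def vec3_eq_0_iff)

lemma inj_point1_line: "inj_on point1 (line_vecs T)"
  by (rule inj_onI, unfold point1_eq_iff)
    (auto simp: line_vecs_def vec3_eq_iff dest!: span_vec3_eqD)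

lemma card_line_vecs:
  assumes "finite T"
  shows "card (line_vecs T) = card T + 1"
proof -
  have "inj_on (\<lambda>t. vec3 1 t 0) T" by (auto simp: inj_on_def vec3_eq_iff)
  moreover have "vec3 0 1 0 \<notin> (\<lambda>t. vec3 1 t 0) ` T" by (auto simp: vec3_eq_iff)
  ultimately show ?thesis using assms by (simp add: line_vecs_def card_image)
qed

lemma line_vecs_span:
  assumes "t \<in> T"
  shows "coord_unit 0 \<in> fvs.span (line_vecs T)" "coord_unit (Suc 0) \<in> fvs.span (line_vecs T)"
proof -
  have unit1: "vec3 0 1 0 \<in> fvs.span (line_vecs T)"
    by (rule fvs.span_base) (simp add: line_vecs_def)
  then show "coord_unit (Suc 0) \<in> fvs.span (line_vecs T)" by (simp only: coord_unit_vec3)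
  have "vec3 1 t 0 - fscale t (vec3 0 1 0) \<in> fvs.span (line_vecs T)"
    by (intro fvs.span_diff fvs.span_scale unit1 fvs.span_base) (use assms in \<open>auto simp: line_vecs_def\<close>)
  then show "coord_unit 0 \<in> fvs.span (line_vecs T)"
    by (simp add: coord_unit_vec3 vec3_diff fscale_vec3)
qed

lemma five_points_on_line:
  assumes "finite (UNIV :: 'a::field set) \<longrightarrow> card (UNIV :: 'a set) \<ge> 4"
  shows "\<exists>k n (S :: (nat \<Rightarrow> (nat \<Rightarrow> 'a) set) set) A. five_point_setup k n S A \<and>
    excess k n S = 3 \<and> A = S \<and> min_multiproj_dims k A = [1]"
proof -
  obtain T :: "'a set" where T: "finite T" "card T = 4" using obtain_scalars[OF assms] .
  then obtain t where t: "t \<in> T" by fastforce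
  define S where "S = point1 ` line_vecs T"
  have units: "coord_unit j \<in> fvs.span (line_vecs T)" if "j \<le> Suc 0" for j
    using that line_vecs_span[OF t] by (cases "j = 0") (auto simp: le_Suc_eq)
  note S = nondegenerate_point1[OF line_vecs_mem units, folded S_def]
  have card: "card S = 5" using card_image[OF inj_point1_line[of T]] card_line_vecs[OF T(1)] T(2) by (simp add: S_def)
  then have fin: "finite S" "S \<noteq> {}" using card.infinite by force+
  have e: "excess 1 (\<lambda>_. Suc 0) S = 3" using excess_nondegenerate_1[OF S(1) fin S(2)] card by simp
  obtain A where A: "five_point_setup 1 (\<lambda>_. Suc 0) S A"
    using five_point_setup_exists[of 1 "\<lambda>_. Suc 0" S] S card e by auto
  with five_point_classification[OF A] e show ?thesis
    by (intro exI[of _ 1] exI[of _ "\<lambda>_. Suc 0"] exI[of _ S] exI[of _ A]) auto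
qed

lemma four_points_on_line:
  assumes "finite (UNIV :: 'a::field set) \<longrightarrow> card (UNIV :: 'a set) \<ge> 3"
  shows "\<exists>k n (S :: (nat \<Rightarrow> (nat \<Rightarrow> 'a) set) set) A. five_point_setup k n S A \<and>
    excess k n S = 2 \<and> card A = 4 \<and> min_multiproj_dims k A = [1]"
proof -
  let ?n = "\<lambda>_::nat. 2::nat"
  obtain T :: "'a set" where T: "finite T" "card T = 3" using obtain_scalars[OF assms] .
  then obtain t where t: "t \<in> T" by fastforce
  \<comment> \<open>Four collinear points and one point off their line, which the kernel must
    omit.\<close>
  define V where "V = insert (vec3 0 0 1) (line_vecs T)"
  define S where "S = point1 ` V"
  have VL: "line_vecs T \<subseteq> V" by (auto simp: V_def)
  have units: "coord_unit j \<in> fvs.span V" if "j \<le> 2" for j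
  proof -
    have "j = 0 \<or> j = Suc 0 \<or> j = 2" using that by arith
    then consider "j = 0" | "j = Suc 0" | "j = 2" by blast
    then show ?thesis
    proof cases
      case 3
      then show ?thesis unfolding coord_unit_vec3 by (intro fvs.span_base) (simp add: V_def coord_unit_vec3)
    qed (use line_vecs_span[OF t] fvs.span_mono[OF VL] in auto)
  qed
  have V: "V \<subseteq> coord_space {..2} - {0}"
    using vec3_mem_plane by (auto simp: V_def line_vecs_def vec3_eq_0_iff)
  note S = nondegenerate_point1[OF V units, folded S_def]
  define L where "L = point1 ` line_vecs T"
  have L: "L \<subseteq> S" using VL by (auto simp: L_def S_def)
  have card_L: "card L = 4" using card_image[OF inj_point1_line[of T]] card_line_vecs[OF T(1)] T(2) by (simp add: L_def)
  have "point1 (vec3 0 0 1) \<notin> L"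
    by (auto simp: L_def line_vecs_def point1_eq_iff dest!: span_vec3_eqD)
  moreover have "finite L" using card_L card.infinite by force
  ultimately have card: "card S = 5"
    using card_L by (simp add: S_def V_def L_def[symmetric])
  then have fin: "finite S" "S \<noteq> {}" using card.infinite by force+
  have e: "excess 1 ?n S = 2" using excess_nondegenerate_1[OF S(1) fin S(2)] card by simp
  have LS: "L \<subset> S" using L card_L card by auto
  have L': "L \<subseteq> multiproj 1 ?n" "finite L" using L S(1) fin(1) finite_subset by auto
  have e_L: "excess 1 ?n L = 2"
  proof -
    \<comment> \<open>The third coordinate vanishes on the line; the other two bound the rank by
      2.\<close>
    let ?I = "{J \<in> multi_idx 1 ?n. J 0 \<le> Suc 0}"
    have "?I \<subseteq> (\<Pi>\<^sub>E i\<in>{..<1}. {..Suc 0})" by (auto simp: multi_idx_def PiE_def)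
    then have "card ?I \<le> card (\<Pi>\<^sub>E i\<in>{..<1::nat}. {..Suc 0})" by (intro card_mono finite_PiE) auto
    also have "\<dots> = 2" by (simp add: card_PiE)
    finally have card_I: "card ?I \<le> 2" .
    have "segre_vec 1 ?n y \<in> coord_space ?I" if "y \<in> L" for y
    proof -
      have "y 0 \<in> proj_of (coord_space {..Suc 0})"
        using that line_vecs_mem[of T] by (auto simp: L_def point1_apply proj_of_def)
      then have "rep (y 0) \<in> coord_space {..Suc 0}" by (rule rep_mem[OF _ subspace_coord_space])
      then show ?thesis by (auto simp: segre_vec_def tensor_def coord_space_def)
    qed
    moreover have "finite ?I" using finite_multi_idx by simp
    ultimately have "rank 1 ?n L \<le> card ?I" by (intro dim_le_card_coord) auto
    then have "rank 1 ?n L = 2" using card_I rank_ge_2[OF L'] card_L by simp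
    then show ?thesis using excess_eq[OF L'(1)] card_L by simp
  qed
  obtain A where A: "five_point_setup 1 ?n S A"
    using five_point_setup_exists[of 1 ?n S] S card e by auto
  have "A \<noteq> S"
  proof
    assume "A = S"
    then show False using A LS e e_L by (auto simp: five_point_setup_def is_kernel_def)
  qed
  with five_point_classification[OF A] e A show ?thesis
    by (intro exI[of _ 1] exI[of _ ?n] exI[of _ S] exI[of _ A]) auto
qed

text \<open>The coordinate points together with [1:1:0] and [1:1:1]. They are distinct even over the
  field with two elements; some three are collinear, but no four are.\<close>

definition plane_vecs :: "(nat \<Rightarrow> 'a::field) set" where
  "plane_vecs = {vec3 1 0 0, vec3 0 1 0, vec3 0 0 1, vec3 1 1 0, vec3 1 1 1}"

text \<open>A unit vector, if removed, is the difference of two of the remaining vectors.\<close>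

lemma plane_vecs_span:
  assumes "v \<in> plane_vecs" "j \<le> 2"
  shows "coord_unit j \<in> fvs.span (plane_vecs - {v})"
proof -
  let ?W = "fvs.span (plane_vecs - {v})"
  have base: "w \<in> plane_vecs \<Longrightarrow> w \<noteq> v \<Longrightarrow> w \<in> ?W" for w by (auto intro: fvs.span_base)
  have mem: "vec3 1 0 0 \<in> (plane_vecs :: (nat \<Rightarrow> 'a) set)" "vec3 0 1 0 \<in> (plane_vecs :: (nat \<Rightarrow> 'a) set)"
    "vec3 0 0 1 \<in> (plane_vecs :: (nat \<Rightarrow> 'a) set)" "vec3 1 1 0 \<in> (plane_vecs :: (nat \<Rightarrow> 'a) set)"
    "vec3 1 1 1 \<in> (plane_vecs :: (nat \<Rightarrow> 'a) set)"
    by (simp_all add: plane_vecs_def)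
  have "vec3 1 1 0 - vec3 0 1 0 \<in> ?W" if "v = vec3 1 0 0"
    by (intro fvs.span_diff base mem) (simp_all add: that vec3_eq_iff)
  then have e0: "vec3 1 0 0 \<in> ?W"
    by (cases "v = vec3 1 0 0") (simp_all add: vec3_diff base mem)
  have "vec3 1 1 0 - vec3 1 0 0 \<in> ?W" if "v = vec3 0 1 0"
    by (intro fvs.span_diff base mem) (simp_all add: that vec3_eq_iff)
  then have e1: "vec3 0 1 0 \<in> ?W"
    by (cases "v = vec3 0 1 0") (simp_all add: vec3_diff base mem)
  have "vec3 1 1 1 - vec3 1 1 0 \<in> ?W" if "v = vec3 0 0 1"
    by (intro fvs.span_diff base mem) (simp_all add: that vec3_eq_iff)
  then have e2: "vec3 0 0 1 \<in> ?W"
    by (cases "v = vec3 0 0 1") (simp_all add: vec3_diff base mem)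
  have "j = 0 \<or> j = Suc 0 \<or> j = 2" using assms(2) by arith
  then consider "j = 0" | "j = Suc 0" | "j = 2" by blast
  then show ?thesis using e0 e1 e2 by cases (simp_all only: coord_unit_vec3)
qed

text \<open>A four-point kernel would be \<open>S\<close> without one point, but any four of these
  points still span the plane, so its dimensions would be \<open>[2]\<close> and not
  \<open>[1]\<close>.\<close>

lemma five_points_in_plane:
  "\<exists>k n (S :: (nat \<Rightarrow> (nat \<Rightarrow> 'a::field) set) set) A. five_point_setup k n S A \<and>
    excess k n S = 2 \<and> A = S \<and> min_multiproj_dims k A = [2]"
proof -
  let ?n = "\<lambda>_::nat. 2::nat"
  let ?V = "plane_vecs :: (nat \<Rightarrow> 'a) set"
  define S where "S = point1 ` ?V"
  have V: "?V \<subseteq> coord_space {..2} - {0}"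
    using vec3_mem_plane by (auto simp: plane_vecs_def vec3_eq_0_iff)
  have inj: "inj_on point1 ?V"
    by (rule inj_onI, unfold point1_eq_iff)
      (auto simp: plane_vecs_def vec3_eq_iff dest!: span_vec3_eqD)
  have "vec3 1 0 0 \<in> ?V" by (simp add: plane_vecs_def)
  then have units: "coord_unit j \<in> fvs.span ?V" if "j \<le> 2" for j
    using plane_vecs_span[OF _ that] fvs.span_mono[of "?V - {vec3 1 0 0}" ?V] by blast
  note S = nondegenerate_point1[OF V units, folded S_def]
  have card: "card S = 5"
    unfolding S_def card_image[OF inj] by (simp add: plane_vecs_def vec3_eq_iff)
  then have fin: "finite S" "S \<noteq> {}" using card.infinite by force+
  have e: "excess 1 ?n S = 2" using excess_nondegenerate_1[OF S(1) fin S(2)] card by simp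
  obtain A where A: "five_point_setup 1 ?n S A"
    using five_point_setup_exists[of 1 ?n S] S card e by auto
  then have AS: "A \<subseteq> S" by (auto simp: five_point_setup_def is_kernel_def)
  have dims: "min_multiproj_dims 1 S = [2]"
    using nondegenerate_dims[OF S fin(2)] by simp
  have "\<not> (card A = 4 \<and> min_multiproj_dims 1 A = [1])"
  proof
    assume asm: "card A = 4 \<and> min_multiproj_dims 1 A = [1]"
    have "card (S - A) = 1" using card_Diff_subset[OF finite_subset[OF AS fin(1)] AS] asm card by simp
    then obtain s where s: "S - A = {s}" unfolding One_nat_def card_1_singleton_iff by (elim exE)
    then have "s \<in> S" by blast
    then obtain v where v: "v \<in> ?V" "S - A = {point1 v}" using s by (auto simp: S_def)
    have "A = S - {point1 v}" using v(2) AS by blast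
    also have "\<dots> = point1 ` (?V - {v})"
      unfolding S_def using inj v(1) by (simp add: inj_on_image_set_diff[of _ ?V])
    finally have A_eq: "A = point1 ` (?V - {v})" .
    have "?V - {v} \<subseteq> coord_space {..2} - {0}" using V by blast
    from nondegenerate_point1[OF this plane_vecs_span[OF v(1)], folded A_eq]
    have "min_multiproj_dims 1 A = [2]"
      using nondegenerate_dims[of A 1 ?n] asm by fastforce
    then show False using asm by simp
  qed
  with five_point_classification[OF A] e dims A show ?thesis
    by (intro exI[of _ 1] exI[of _ ?n] exI[of _ S] exI[of _ A]) auto
qed

definition cross_point :: "(nat \<Rightarrow> 'a::field) \<Rightarrow> (nat \<Rightarrow> 'a) \<Rightarrow> nat \<Rightarrow> (nat \<Rightarrow> 'a) set" where
  "cross_point u w = mpoint 2 (\<lambda>i. if i = 0 then u else w)"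

lemma cross_point_apply:
  "cross_point u w 0 = fvs.span {u}" "cross_point u w (Suc 0) = fvs.span {w}"
  by (simp_all add: cross_point_def mpoint_def)

lemma cross_point_eq_iff:
  "cross_point u w = cross_point u' w' \<longleftrightarrow>
     fvs.span {u} = fvs.span {u'} \<and> fvs.span {w} = fvs.span {w'}"
proof
  assume eq: "cross_point u w = cross_point u' w'"
  show "fvs.span {u} = fvs.span {u'} \<and> fvs.span {w} = fvs.span {w'}"
    using fun_cong[OF eq, of 0] fun_cong[OF eq, of "Suc 0"] by (simp add: cross_point_apply)
qed (auto simp: cross_point_def mpoint_def intro!: restrict_ext)

text \<open>A reducible plane section of the quadric surface, namely five points on two meeting lines;
  smooth conics do not suffice here, as over the field with two elements they only have three points.\<close>

lemma five_points_on_quadric: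
  "\<exists>k n (S :: (nat \<Rightarrow> (nat \<Rightarrow> 'a::field) set) set) A. five_point_setup k n S A \<and>
    excess k n S = 2 \<and> A = S \<and> min_multiproj_dims k A = [1, 1]"
proof -
  let ?n = "\<lambda>_::nat. Suc 0"
  let ?a = "vec3 1 0 0 :: nat \<Rightarrow> 'a" and ?b = "vec3 0 1 0 :: nat \<Rightarrow> 'a" and ?c = "vec3 1 1 0 :: nat \<Rightarrow> 'a"
  define S where "S = {cross_point ?a ?a, cross_point ?a ?b, cross_point ?a ?c, cross_point ?b ?a, cross_point ?c ?a}"
  have ne: "fvs.span {?a} \<noteq> fvs.span {?b}" "fvs.span {?a} \<noteq> fvs.span {?c}" "fvs.span {?b} \<noteq> fvs.span {?c}"
    by (auto dest!: span_vec3_eqD)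
  have card: "card S = 5"
    by (simp add: S_def card_insert_if cross_point_eq_iff ne ne[symmetric])
  then have fin: "finite S" "S \<noteq> {}" using card.infinite by force+
  have sub: "S \<subseteq> multiproj 2 ?n"
    unfolding S_def cross_point_def
    by (simp, intro conjI mpoint_mem) (simp_all add: vec3_mem_line vec3_eq_0_iff)
  have nondeg: "nondegenerate 2 ?n S"
  proof (rule nondegenerateI[OF sub])
    fix i j :: nat assume ij: "i < 2" "j \<le> Suc 0"
    have ab: "?a \<in> (\<Union>y\<in>S. y i)" "?b \<in> (\<Union>y\<in>S. y i)"
      using ij(1) fvs.span_base[of ?a "{?a}"] fvs.span_base[of ?b "{?b}"]
      by (auto simp: S_def cross_point_apply less_2_cases_iff)
    then show "coord_unit j \<in> fvs.span (\<Union>y\<in>S. y i)"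
      using ij(2) by (cases "j = 0") (auto simp: coord_unit_vec3 le_Suc_eq intro: fvs.span_base)
  qed
  \<comment> \<open>A lower bound is enough: in the classification, the dimensions
    \<open>[1, 1]\<close> of \<open>S\<close> exclude excess 3.\<close>
  have e2: "2 \<le> excess 2 ?n S"
  proof -
    \<comment> \<open>The multi-index (1,1). Each point of \<open>S\<close> has the first coordinate
      point as one of its projections, so its tensor vanishes at \<open>?J\<close>: this coordinate
      cuts out the plane section containing \<open>S\<close>.\<close>
    let ?J = "\<lambda>i\<in>{..<2::nat}. Suc 0"
    let ?I = "multi_idx 2 ?n - {?J}"
    have fin_idx: "finite (multi_idx 2 ?n)" by (rule finite_multi_idx)
    have "?J \<in> multi_idx 2 ?n" by (auto simp: multi_idx_def)
    then have card_I: "card ?I = 3" using fin_idx by (simp add: card_multi_idx power2_eq_square)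
    have "segre_vec 2 ?n y \<in> coord_space ?I" if y: "y \<in> S" for y
    proof -
      have "\<exists>i<2. y i = fvs.span {?a}" using y by (auto simp: S_def cross_point_apply intro: exI[of _ 0] exI[of _ 1])
      then obtain i where i: "i < 2" "y i = fvs.span {?a}" by blast
      have "rep (y i) \<in> fvs.span {?a}"
        using rep_mem[of "y i" "fvs.span {?a}"] i(2) vec3_eq_0_iff[of 1 0 0]
        by (auto simp: proj_of_def intro: fvs.span_base)
      then have "rep (y i) (Suc 0) = 0" by (auto simp: fvs.span_singleton fscale_def vec3_def)
      then have "\<exists>m<2. rep (y m) (?J m) = 0" using i(1) by auto
      then have "(\<Prod>m<2. rep (y m) (?J m)) = 0" by auto
      then show ?thesis by (auto simp: segre_vec_def tensor_def coord_space_def simp del: prod_zero_iff)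
    qed
    then have "rank 2 ?n S \<le> card ?I" using fin_idx by (intro dim_le_card_coord) auto
    then show ?thesis using excess_eq[OF sub] card card_I by simp
  qed
  have dims: "min_multiproj_dims 2 S = [1, 1]"
    using nondegenerate_dims[OF sub nondeg fin(2)] by (simp add: upt_rec)
  obtain A where A: "five_point_setup 2 ?n S A"
    using five_point_setup_exists[of 2 ?n S] sub nondeg card e2 by auto
  then have AS: "A \<subseteq> S" by (auto simp: five_point_setup_def is_kernel_def)
  have A': "A \<subseteq> multiproj 2 ?n" "finite A" using AS sub fin(1) finite_subset by auto
  have "\<not> (card A = 4 \<and> min_multiproj_dims 2 A = [1])"
  proof
    assume asm: "card A = 4 \<and> min_multiproj_dims 2 A = [1]"
    have "card (S - A) = 1" using card_Diff_subset[OF A'(2) AS] asm card by simp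
    then obtain s where s: "S - A = {s}" unfolding One_nat_def card_1_singleton_iff by (elim exE)
    \<comment> \<open>\<open>A\<close> misses one point of \<open>S\<close> and hence meets every
      pair. Suitable pairs show that both projections of \<open>A\<close> are nonconstant, which
      contradicts the dimensions \<open>[1]\<close>.\<close>
    have pick: "y \<in> A \<or> z \<in> A" if "y \<in> S" "z \<in> S" "y \<noteq> z" for y z
      using s that by (metis DiffI singletonD)
    have aa: "cross_point ?a ?a \<in> A \<or> cross_point ?a ?b \<in> A" "cross_point ?a ?a \<in> A \<or> cross_point ?b ?a \<in> A"
      and bc: "cross_point ?b ?a \<in> A \<or> cross_point ?c ?a \<in> A" "cross_point ?a ?b \<in> A \<or> cross_point ?a ?c \<in> A"
      by (rule pick; simp add: S_def cross_point_eq_iff ne)+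
    have "\<not> agree_at A 0"
    proof -
      have "\<exists>y\<in>A. y 0 = fvs.span {?a}" using aa(1) cross_point_apply(1) by blast
      moreover have "\<exists>y\<in>A. y 0 \<noteq> fvs.span {?a}"
        using bc(1) cross_point_apply(1)[of ?b ?a] cross_point_apply(1)[of ?c ?a] ne by metis
      ultimately show ?thesis by (metis agree_atD)
    qed
    moreover have "\<not> agree_at A (Suc 0)"
    proof -
      have "\<exists>y\<in>A. y (Suc 0) = fvs.span {?a}" using aa(2) cross_point_apply(2) by blast
      moreover have "\<exists>y\<in>A. y (Suc 0) \<noteq> fvs.span {?a}"
        using bc(2) cross_point_apply(2)[of ?a ?b] cross_point_apply(2)[of ?a ?c] ne by metis
      ultimately show ?thesis by (metis agree_atD)
    qed
    ultimately have "\<not> agree_at A i" if "i < 2" for i using that by (auto simp: less_2_cases_iff)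
    then have "2 \<le> factor_rank A i" if "i < 2" for i using factor_rank_ge_2[OF A' that] that by blast
    from this[of 0] this[of 1] have "length (min_multiproj_dims 2 A) = 2"
      by (simp add: dims_eq[OF A'(1)] upt_rec)
    then show False using asm by simp
  qed
  with five_point_classification[OF A] dims A show ?thesis
    by (intro exI[of _ 2] exI[of _ ?n] exI[of _ S] exI[of _ A]) auto
qed

theorem proposition5p6:
  "(\<forall>k n (S :: (nat \<Rightarrow> (nat \<Rightarrow> 'a::field) set) set) A. five_point_setup k n S A \<longrightarrow>
      (excess k n S = 3 \<and> A = S \<and> min_multiproj_dims k A = [1]) \<or>
      (excess k n S = 2 \<and> A = S \<and> min_multiproj_dims k A = [2]) \<or>
      (excess k n S = 2 \<and> A = S \<and> min_multiproj_dims k A = [1, 1]) \<or>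
      (excess k n S = 2 \<and> card A = 4 \<and> min_multiproj_dims k A = [1])) \<and>
   ((finite (UNIV :: 'a set) \<longrightarrow> card (UNIV :: 'a set) \<ge> 4) \<longrightarrow>
      (\<exists>k n (S :: (nat \<Rightarrow> (nat \<Rightarrow> 'a) set) set) A. five_point_setup k n S A \<and>
         excess k n S = 3 \<and> A = S \<and> min_multiproj_dims k A = [1])) \<and>
   (\<exists>k n (S :: (nat \<Rightarrow> (nat \<Rightarrow> 'a) set) set) A. five_point_setup k n S A \<and>
      excess k n S = 2 \<and> A = S \<and> min_multiproj_dims k A = [2]) \<and>
   (\<exists>k n (S :: (nat \<Rightarrow> (nat \<Rightarrow> 'a) set) set) A. five_point_setup k n S A \<and>
      excess k n S = 2 \<and> A = S \<and> min_multiproj_dims k A = [1, 1]) \<and>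
   ((finite (UNIV :: 'a set) \<longrightarrow> card (UNIV :: 'a set) \<ge> 3) \<longrightarrow>
      (\<exists>k n (S :: (nat \<Rightarrow> (nat \<Rightarrow> 'a) set) set) A. five_point_setup k n S A \<and>
         excess k n S = 2 \<and> card A = 4 \<and> min_multiproj_dims k A = [1]))"
  by (intro conjI allI impI)
    (rule five_point_classification, assumption | rule five_points_on_line, assumption |
      rule five_points_in_plane | rule five_points_on_quadric | rule four_points_on_line, assumption)+

end
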